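(* For a pair $(X,A)$, the following are equivalent: (1) $(X,A)$ has strong computable type; (2) there exists a topological invariant of the form $\bigcup_{n\in\mathbb N}\mathcal P_n$, where the sets $\mathcal P_n\subseteq\mathcal K(Q)^2$ are uniformly $\Pi^0_1$ in the product of upper Vietoris topologies, such that every copy of $(X,A)$ in $Q$ is $\mathcal P_n$-minimal for some $n$.
   Context: $Q=[0,1]^{\mathbb N}$ is the Hilbert cube with metric $d_Q(x,y)=\sum_i2^{-i}|x_i-y_i|$ and rational open balls centered at rational points with finitely many nonzero coordinates. A pair $(X,A)$ is a compact metrizable space $X$ with compact $A\subseteq X$; a copy of it in $Q$ is $(Y,B)$ with $Y\subseteq Q$ and a homeomorphism $X\to Y$ sending $A$ onto $B$. A compact $K\subseteq Q$ is semicomputable relative to an oracle $O$ if the set of finite lists of rational balls whose union contains $K$ is c.e. relative to $O$; computable relative to $O$ if moreover the set of rational balls meeting $K$ is c.e. relative to $O$. $(X,A)$ has strong computable type if for every oracle $O$ and every copy $(Y,B)$ in $Q$ with $Y,B$ semicomputable relative to $O$, $Y$ is computable relative to $O$. $\mathcal K(Q)$ is the set of compact subsets of $Q$, with the upper Vietoris topology having basis $\{K:K\subseteq U\}$, $U$ ranging over finite unions of rational balls (effectively numbered); $\mathcal K(Q)^2$ carries the product topology. A set is $\Pi^0_1$ if its complement is a union of a c.e. family of basic open sets; uniformly $\Pi^0_1$ means the c.e. families are given by a single c.e. procedure in $n$. A property of pairs is a subset of $\mathcal K(Q)^2$; it is a topological invariant if it contains every copy in $Q$ of each of its elements. $(X',A')$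 is a proper subpair of $(X,A)$ if $X'\subsetneq X$, $A'\subseteq A$. A pair in $Q$ is $\mathcal P$-minimal if it belongs to $\mathcal P$ and none of its proper subpairs does. *)

theory Defs
  imports "HOL-Analysis.Analysis" "HOL-Library.Nat_Bijection"
begin

text \<open>
  Partial recursive functions relative to a set of natural numbers, as unary functions with
  arguments coded by the Cantor pairing function. In \<open>rec\<close> the argument codes a parameter and the
  recursion counter; in \<open>mu\<close> it is the parameter, and \<open>f\<close> must converge up to its first zero.
\<close>

inductive partial_recursive_in :: "nat set \<Rightarrow> (nat \<rightharpoonup> nat) \<Rightarrow> bool" for Z :: "nat set" where
  zero: "partial_recursive_in Z (\<lambda>_. Some 0)"
| succ: "partial_recursive_in Z (\<lambda>n. Some (Suc n))"
| left: "partial_recursive_in Z (\<lambda>n. Some (fst (prod_decode n)))"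
| right: "partial_recursive_in Z (\<lambda>n. Some (snd (prod_decode n)))"
| query: "partial_recursive_in Z (\<lambda>n. Some (if n \<in> Z then 1 else 0))"
| pair: "partial_recursive_in Z f \<Longrightarrow> partial_recursive_in Z g \<Longrightarrow>
    partial_recursive_in Z
      (\<lambda>n. Option.bind (f n) (\<lambda>a. Option.bind (g n) (\<lambda>b. Some (prod_encode (a, b)))))"
| comp: "partial_recursive_in Z f \<Longrightarrow> partial_recursive_in Z g \<Longrightarrow>
    partial_recursive_in Z (\<lambda>n. Option.bind (g n) f)"
| rec: "partial_recursive_in Z f \<Longrightarrow> partial_recursive_in Z g \<Longrightarrow>
    partial_recursive_in Z
      (\<lambda>n. rec_nat (f (fst (prod_decode n)))
        (\<lambda>k r. Option.bind r
          (\<lambda>v. g (prod_encode (fst (prod_decode n), prod_encode (k, v)))))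
        (snd (prod_decode n)))"
| mu: "partial_recursive_in Z f \<Longrightarrow>
    partial_recursive_in Z
      (\<lambda>a. if \<exists>k. f (prod_encode (a, k)) = Some 0 \<and> (\<forall>j<k. f (prod_encode (a, j)) \<noteq> None)
           then Some (LEAST k. f (prod_encode (a, k)) = Some 0) else None)"

definition ce_in :: "nat set \<Rightarrow> nat set \<Rightarrow> bool" where
  "ce_in Z S \<longleftrightarrow> (\<exists>f. partial_recursive_in Z f \<and> S = dom f)"

abbreviation ce :: "nat set \<Rightarrow> bool" where
  "ce \<equiv> ce_in {}"

definition hcube :: "(nat \<Rightarrow> real) set" where
  "hcube = {x. \<forall>i. x i \<in> {0..1}}"

definition hdist :: "(nat \<Rightarrow> real) \<Rightarrow> (nat \<Rightarrow> real) \<Rightarrow> real" where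
  "hdist x y = (\<Sum>\<^sub>\<infinity>i. \<bar>x i - y i\<bar> / 2 ^ i)"

text \<open>
  \<open>infsum\<close> rather than \<open>suminf\<close> because outside \<open>hcube\<close> the series may diverge, and \<open>Metric_space\<close>
  demands nonnegativity everywhere (a divergent \<open>infsum\<close> is 0). The type class metric on
  \<open>nat \<Rightarrow> real\<close> is a different one and is not used.
\<close>

abbreviation hcube_topology :: "(nat \<Rightarrow> real) topology" where
  "hcube_topology \<equiv> Metric_space.mtopology hcube hdist"

definition compacts :: "(nat \<Rightarrow> real) set set" where
  "compacts = {K. compactin hcube_topology K}"

lemma summable_hdist:
  assumes "x \<in> hcube" "y \<in> hcube"
  shows "summable (\<lambda>i. \<bar>x i - y i\<bar> / 2 ^ i)"
proof (rule summable_comparison_test)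
  have "\<bar>x i - y i\<bar> \<le> 1" for i
  proof -
    have "0 \<le> x i" "x i \<le> 1" "0 \<le> y i" "y i \<le> 1"
      using assms by (auto simp: hcube_def)
    then show ?thesis by linarith
  qed
  then show "\<exists>N. \<forall>n\<ge>N. norm (\<bar>x n - y n\<bar> / 2 ^ n) \<le> (1/2) ^ n"
    by (intro exI[of _ 0]) (simp add: power_one_over divide_right_mono)
qed (simp add: summable_geometric)

lemma hdist_eq_suminf:
  assumes "x \<in> hcube" "y \<in> hcube"
  shows "hdist x y = (\<Sum>i. \<bar>x i - y i\<bar> / 2 ^ i)"
  unfolding hdist_def
  by (intro infsumI norm_summable_imp_has_sum summable_sums)
     (use summable_hdist[OF assms] in simp_all)

lemma Metric_space_hcube: "Metric_space hcube hdist"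
proof
  show "0 \<le> hdist x y" for x y
    unfolding hdist_def by (intro infsum_nonneg) simp
  show "hdist x y = hdist y x" for x y
    by (simp add: hdist_def abs_minus_commute)
  fix x y assume xy: "x \<in> hcube" "y \<in> hcube"
  show "hdist x y = 0 \<longleftrightarrow> x = y"
    unfolding hdist_eq_suminf[OF xy] using suminf_eq_zero_iff[OF summable_hdist[OF xy]] by auto
  fix z assume z: "z \<in> hcube"
  have "hdist x z \<le> (\<Sum>i. \<bar>x i - y i\<bar> / 2 ^ i + \<bar>y i - z i\<bar> / 2 ^ i)"
    unfolding hdist_eq_suminf[OF xy(1) z]
    by (intro suminf_le summable_add summable_hdist xy z)
       (auto simp: add_divide_distrib[symmetric] intro!: divide_right_mono)
  also have "\<dots> = hdist x y + hdist y z"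
    unfolding hdist_eq_suminf[OF xy] hdist_eq_suminf[OF xy(2) z]
    by (intro suminf_add[symmetric] summable_hdist xy z)
  finally show "hdist x z \<le> hdist x y + hdist y z" .
qed

lemma hcube_topology_eq_product:
  "hcube_topology = product_topology (\<lambda>_. top_of_set {0..1}) UNIV"
proof -
  interpret Metric_space hcube hdist by (rule Metric_space_hcube)
  let ?T = "product_topology (\<lambda>_::nat. top_of_set {0..1::real}) UNIV"
  have top: "topspace ?T = hcube"
    by (auto simp: hcube_def PiE_def)
  have "openin hcube_topology U \<longleftrightarrow> openin ?T U" for U
  proof
    assume U: "openin hcube_topology U"
    show "openin ?T U"
    proof (subst openin_subopen, intro ballI)
      fix x assume xU: "x \<in> U"
      then obtain r where r: "r > 0" "mball x r \<subseteq> U" and x: "x \<in> hcube"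
        using U unfolding openin_mtopology by blast
      obtain N where N: "(1/2::real) ^ N < r / 4"
        using real_arch_pow_inv[of "r/4" "1/2"] r by auto
      define V where
        "V = (\<Pi>\<^sub>E i\<in>(UNIV::nat set). if i < N then {0..1} \<inter> ball (x i) (r / 4) else {0..1::real})"
      have "openin ?T V"
        unfolding V_def
      proof (rule product_topology_basis)
        show "openin (top_of_set {0..1}) (if i < N then {0..1} \<inter> ball (x i) (r / 4) else {0..1})" for i
          by (auto simp: openin_open)
        have "{i. (if i < N then {0..1} \<inter> ball (x i) (r / 4) else {0..1}) \<noteq> topspace (top_of_set {0..1::real})}
                \<subseteq> {..<N}"
          by auto
        then show "finite {i. (if i < N then {0..1} \<inter> ball (x i) (r / 4) else {0..1}) \<noteq> topspace (top_of_set {0..1::real})}"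
          using finite_subset by blast
      qed
      moreover have "x \<in> V"
        using x r by (auto simp: V_def hcube_def)
      moreover have "V \<subseteq> mball x r"
      proof
        fix y assume y: "y \<in> V"
        have yi: "y i \<in> (if i < N then {0..1} \<inter> ball (x i) (r / 4) else {0..1})" for i
          using y by (auto simp: V_def PiE_iff)
        have yc: "y \<in> hcube"
        proof -
          have "y i \<in> {0..1}" for i using yi[of i] by (cases "i < N") auto
          then show ?thesis by (simp add: hcube_def)
        qed
        have *: "\<bar>x i - y i\<bar> / 2 ^ i \<le> (r/4) * (1/2) ^ i + (if i < N then 0 else (1/2) ^ i)" for i
        proof (cases "i < N")
          case True
          then have "\<bar>x i - y i\<bar> \<le> r / 4" using yi[of i] by (auto simp: dist_real_def)
          then have "\<bar>x i - y i\<bar> / 2 ^ i \<le> (r / 4) / 2 ^ i" by (rule divide_right_mono) simp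
          then show ?thesis using True by (simp add: power_one_over)
        next
          case False
          have "0 \<le> x i" "x i \<le> 1" "0 \<le> y i" "y i \<le> 1"
            using x yc by (auto simp: hcube_def)
          then have "\<bar>x i - y i\<bar> \<le> r / 4 + 1" using r by linarith
          then have "\<bar>x i - y i\<bar> / 2 ^ i \<le> (r / 4 + 1) / 2 ^ i" by (rule divide_right_mono) simp
          then show ?thesis using False by (simp add: power_one_over add_divide_distrib)
        qed
        have g: "(\<lambda>i. (1/2::real) ^ i) sums 2"
          using geometric_sums[of "1/2::real"] by simp
        have t: "(\<lambda>i. if i < N then 0 else (1/2::real) ^ i) sums (2 * (1/2) ^ N)"
        proof -
          have "(\<lambda>i. (1/2::real) ^ (i + N)) sums (2 * (1/2) ^ N)"
            using sums_mult2[OF g, of "(1/2) ^ N"] by (simp add: power_add)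
          then have "(\<lambda>i. if i + N < N then 0 else (1/2::real) ^ (i + N)) sums (2 * (1/2) ^ N)"
            by simp
          then show ?thesis
            by (subst (asm) sums_iff_shift) simp
        qed
        have s: "(\<lambda>i. (r/4) * (1/2) ^ i + (if i < N then 0 else (1/2) ^ i)) sums ((r/4) * 2 + 2 * (1/2) ^ N)"
          by (intro sums_add sums_mult g t)
        have "hdist x y \<le> (r/4) * 2 + 2 * (1/2) ^ N"
          unfolding hdist_eq_suminf[OF x yc]
          using sums_le[OF * summable_sums[OF summable_hdist[OF x yc]] s] .
        also have "\<dots> < r" using N by simp
        finally show "y \<in> mball x r" using x yc by simp
      qed
      ultimately show "\<exists>V. openin ?T V \<and> x \<in> V \<and> V \<subseteq> U"
        using r by blast
    qed
  next
    assume U: "openin ?T U"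
    show "openin hcube_topology U"
      unfolding openin_mtopology
    proof (intro conjI allI impI)
      show "U \<subseteq> hcube" using openin_subset[OF U] top by simp
      fix x assume xU: "x \<in> U"
      then have x: "x \<in> hcube" using \<open>U \<subseteq> hcube\<close> by blast
      obtain V where V: "x \<in> (\<Pi>\<^sub>E i\<in>UNIV. V i)" "\<And>i. openin (top_of_set {0..1::real}) (V i)"
          "finite {i. V i \<noteq> topspace (top_of_set {0..1})}" "(\<Pi>\<^sub>E i\<in>UNIV. V i) \<subseteq> U"
        using product_topology_open_contains_basis[OF U xU] by auto
      have "\<exists>e>0. \<forall>z\<in>{0..1}. \<bar>x i - z\<bar> < e \<longrightarrow> z \<in> V i" for i
      proof -
        have "x i \<in> V i" using V(1) by auto
        then obtain e where "e > 0" "ball (x i) e \<inter> {0..1} \<subseteq> V i"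
          using V(2)[of i] unfolding openin_contains_ball by blast
        then show ?thesis by (intro exI[of _ e]) (auto simp: dist_real_def)
      qed
      then obtain e where e: "\<And>i. e i > 0" "\<And>i z. z \<in> {0..1} \<Longrightarrow> \<bar>x i - z\<bar> < e i \<Longrightarrow> z \<in> V i"
        by metis
      define F where "F = {i. V i \<noteq> {0..1}}"
      have F: "finite F" using V(3) by (simp add: F_def)
      define r where "r = Min (insert 1 ((\<lambda>i. e i / 2 ^ i) ` F))"
      have r0: "r > 0" using F e(1) by (simp add: r_def)
      have "mball x r \<subseteq> U"
      proof
        fix y assume "y \<in> mball x r"
        then have y: "y \<in> hcube" "hdist x y < r" by auto
        have "y i \<in> V i" for i
        proof (cases "i \<in> F")
          case False
          then show ?thesis using y by (simp add: F_def hcube_def)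
        next
          case True
          have "\<bar>x i - y i\<bar> / 2 ^ i \<le> hdist x y"
            unfolding hdist_eq_suminf[OF x y(1)]
            using sum_le_suminf[OF summable_hdist[OF x y(1)], of "{i}"] by simp
          also have "\<dots> < e i / 2 ^ i"
            using y(2) True F by (auto simp: r_def)
          finally have "\<bar>x i - y i\<bar> < e i" by (simp add: divide_less_cancel)
          then show ?thesis using e(2) y(1) by (auto simp: hcube_def)
        qed
        then show "y \<in> U" using V(4) by auto
      qed
      with r0 show "\<exists>r>0. mball x r \<subseteq> U" by blast
    qed
  qed
  then show ?thesis by (simp add: topology_eq)
qed

text \<open>
  Natural numbers code rationals in $[0,1]$, rational points (lists of coordinates, continued by
  zeros) and rational balls (a rational point together with a positive rational radius).
\<close>

definition rat01 :: "nat \<Rightarrow> real" where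
  "rat01 c = (case prod_decode c of (a, b) \<Rightarrow> min 1 (real a / real (Suc b)))"

definition rat_point :: "nat \<Rightarrow> nat \<Rightarrow> real" where
  "rat_point c i = (let l = list_decode c in if i < length l then rat01 (l ! i) else 0)"

definition rat_radius :: "nat \<Rightarrow> real" where
  "rat_radius c = (case prod_decode c of (a, b) \<Rightarrow> real (Suc a) / real (Suc b))"

definition rat_ball :: "nat \<Rightarrow> (nat \<Rightarrow> real) set" where
  "rat_ball n =
    (case prod_decode n of (c, r) \<Rightarrow> Metric_space.mball hcube hdist (rat_point c) (rat_radius r))"

definition ball_union :: "nat \<Rightarrow> (nat \<Rightarrow> real) set" where
  "ball_union e = (\<Union>n\<in>set (list_decode e). rat_ball n)"

lemma range_rat01: "range rat01 = {0..1} \<inter> \<rat>"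
proof (intro equalityI subsetI)
  fix q assume "q \<in> range rat01"
  then show "q \<in> {0..1} \<inter> \<rat>"
    by (auto simp: rat01_def min_def split: prod.splits)
next
  fix q :: real assume q: "q \<in> {0..1} \<inter> \<rat>"
  then obtain m n :: nat where mn: "n \<noteq> 0" "\<bar>q\<bar> = real m / real n"
    using Rats_abs_nat_div_natE by (metis IntD2)
  then have "rat01 (prod_encode (m, n - 1)) = q"
    using q by (simp add: rat01_def)
  then show "q \<in> range rat01" by blast
qed

lemma range_rat_point:
  "range rat_point = {x. (\<forall>i. x i \<in> {0..1} \<inter> \<rat>) \<and> finite {i. x i \<noteq> 0}}"
proof (intro equalityI subsetI)
  fix x assume "x \<in> range rat_point"
  then obtain c where x: "x = rat_point c" by blast
  have "{i. x i \<noteq> 0} \<subseteq> {..<length (list_decode c)}"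
    by (auto simp: x rat_point_def Let_def split: if_splits)
  moreover have "x i \<in> {0..1} \<inter> \<rat>" for i
    unfolding x rat_point_def Let_def using range_rat01 by auto
  ultimately show "x \<in> {x. (\<forall>i. x i \<in> {0..1} \<inter> \<rat>) \<and> finite {i. x i \<noteq> 0}}"
    using finite_subset by blast
next
  fix x :: "nat \<Rightarrow> real"
  assume "x \<in> {x. (\<forall>i. x i \<in> {0..1} \<inter> \<rat>) \<and> finite {i. x i \<noteq> 0}}"
  then have x: "\<And>i. x i \<in> range rat01" and fin: "finite {i. x i \<noteq> 0}"
    unfolding range_rat01 by auto
  obtain N where "\<forall>i\<in>{i. x i \<noteq> 0}. i < N"
    using fin unfolding finite_nat_set_iff_bounded by blast
  then have N: "x i = 0" if "\<not> i < N" for i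
    using that by blast
  define g where "g i = inv rat01 (x i)" for i
  have g: "rat01 (g i) = x i" for i
    unfolding g_def using x by (rule f_inv_into_f)
  have "rat_point (list_encode (map g [0..<N])) = x"
    by (rule ext) (simp add: rat_point_def g N)
  then show "x \<in> range rat_point" by blast
qed

lemma range_rat_radius: "range rat_radius = {r. r \<in> \<rat> \<and> r > 0}"
proof (intro equalityI subsetI)
  fix q assume "q \<in> range rat_radius"
  then show "q \<in> {r. r \<in> \<rat> \<and> r > 0}"
    by (auto simp: rat_radius_def simp del: of_nat_Suc split: prod.splits)
next
  fix q :: real assume q: "q \<in> {r. r \<in> \<rat> \<and> r > 0}"
  then obtain m n :: nat where mn: "n \<noteq> 0" "\<bar>q\<bar> = real m / real n"
    using Rats_abs_nat_div_natE by (metis mem_Collect_eq)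
  then have "m \<noteq> 0" using q by (cases m) auto
  with mn have "rat_radius (prod_encode (m - 1, n - 1)) = q"
    using q by (simp add: rat_radius_def)
  then show "q \<in> range rat_radius" by blast
qed

definition semicomputable_in :: "nat set \<Rightarrow> (nat \<Rightarrow> real) set \<Rightarrow> bool" where
  "semicomputable_in Z K \<longleftrightarrow> K \<in> compacts \<and> ce_in Z {e. K \<subseteq> ball_union e}"

definition computable_in :: "nat set \<Rightarrow> (nat \<Rightarrow> real) set \<Rightarrow> bool" where
  "computable_in Z K \<longleftrightarrow> semicomputable_in Z K \<and> ce_in Z {n. rat_ball n \<inter> K \<noteq> {}}"

definition compact_pair :: "'a topology \<Rightarrow> 'a set \<Rightarrow> bool" where
  "compact_pair X A \<longleftrightarrow> compact_space X \<and> metrizable_space X \<and> compactin X A"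

abbreviation subspace :: "(nat \<Rightarrow> real) set \<Rightarrow> (nat \<Rightarrow> real) topology" where
  "subspace Y \<equiv> subtopology hcube_topology Y"

definition copy_of :: "'a topology \<Rightarrow> 'a set \<Rightarrow> (nat \<Rightarrow> real) set \<Rightarrow> (nat \<Rightarrow> real) set \<Rightarrow> bool" where
  "copy_of X A Y B \<longleftrightarrow> Y \<subseteq> hcube \<and> (\<exists>f. homeomorphic_map X (subspace Y) f \<and> f ` A = B)"

definition strong_computable_type :: "'a topology \<Rightarrow> 'a set \<Rightarrow> bool" where
  "strong_computable_type X A \<longleftrightarrow>
    (\<forall>Z Y B. copy_of X A Y B \<and> semicomputable_in Z Y \<and> semicomputable_in Z B \<longrightarrow>
       computable_in Z Y)"

type_synonym pair_property = "((nat \<Rightarrow> real) set \<times> (nat \<Rightarrow> real) set) set"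

text \<open>
  Basic open sets of the upper Vietoris topology; their binary products are the basic open sets of
  the product topology on \<open>compacts \<times> compacts\<close>.
\<close>

definition upper_basic :: "nat \<Rightarrow> (nat \<Rightarrow> real) set set" where
  "upper_basic e = {K \<in> compacts. K \<subseteq> ball_union e}"

definition uniformly_Pi01 :: "(nat \<Rightarrow> pair_property) \<Rightarrow> bool" where
  "uniformly_Pi01 P \<longleftrightarrow> (\<exists>W. ce W \<and> (\<forall>n. P n \<subseteq> compacts \<times> compacts \<and>
     compacts \<times> compacts - P n =
       (\<Union>(d, e) \<in> {(d, e). prod_encode (n, prod_encode (d, e)) \<in> W}.
          upper_basic d \<times> upper_basic e)))"

text \<open>
  A property may contain elements \<open>(K, L)\<close> with \<open>L\<close> not contained in \<open>K\<close>. These are not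
  pairs, have no copies, and impose no condition on a topological invariant.
\<close>

definition topological_invariant :: "pair_property \<Rightarrow> bool" where
  "topological_invariant P \<longleftrightarrow> P \<subseteq> compacts \<times> compacts \<and>
     (\<forall>(K, L) \<in> P. L \<subseteq> K \<longrightarrow> (\<forall>Y B. copy_of (subspace K) L Y B \<longrightarrow> (Y, B) \<in> P))"

definition proper_subpair ::
  "(nat \<Rightarrow> real) set \<Rightarrow> (nat \<Rightarrow> real) set \<Rightarrow> (nat \<Rightarrow> real) set \<Rightarrow> (nat \<Rightarrow> real) set \<Rightarrow> bool" where
  "proper_subpair K L Y B \<longleftrightarrow>
     K \<in> compacts \<and> L \<in> compacts \<and> L \<subseteq> K \<and> K \<subset> Y \<and> L \<subseteq> B"

definition minimal_for :: "pair_property \<Rightarrow> (nat \<Rightarrow> real) set \<Rightarrow> (nat \<Rightarrow> real) set \<Rightarrow> bool" where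
  "minimal_for P Y B \<longleftrightarrow> (Y, B) \<in> P \<and> (\<forall>K L. proper_subpair K L Y B \<longrightarrow> (K, L) \<notin> P)"

end

theory Submission
  imports Defs
begin

text \<open>
  If \<open>(Y, B)\<close> is minimal for a \<open>\<Pi>\<^sup>0\<^sub>1\<close> property, then an open ball \<open>b\<close> meets \<open>Y\<close> iff
  \<open>(Y - b, B - b)\<close> violates the property, and this can be enumerated from the neighbourhoods of
  \<open>Y\<close> and \<open>B\<close>.

  Conversely, strong computable type says that every oracle enumerating the neighbourhoods of
  \<open>(Y, B)\<close> enumerates the balls meeting \<open>Y\<close>. By Selman's theorem a single enumeration operator does
  this. The \<open>n\<close>-th property holds of \<open>(K, L)\<close> if the \<open>n\<close>-th operator, applied to the neighbourhoods
  of \<open>(K, L)\<close>, enumerates no ball that lies effectively apart from \<open>K\<close>. A proper subpair of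
  \<open>(Y, B)\<close> has more neighbourhoods, so the operator still enumerates a ball around some point of
  \<open>Y - K\<close>, and \<open>(Y, B)\<close> is minimal. The empty operator yields the property that holds of all pairs,
  so the union of the properties is trivially invariant.
\<close>

text \<open>Strong computable type is non-uniform: for each oracle it promises some program, which
  may depend on the oracle and on the copy. Enumeration operators remove the dependence on the
  oracle. They read only positive information, finitely many neighbourhoods per output, so their
  outputs survive when neighbourhoods are added; a program that queries an oracle could behave
  differently on a subpair. Different copies may still need different operators, hence a countable
  union, made uniform by listing all operators in one universal c.e. set.

  The complement of each property must be open in the upper Vietoris topology and enumerable. Being
  disjoint from an open ball is in general not an open condition on \<open>K\<close>, so
  disjointness and inclusion are replaced by inequalities between centres and radii,
  \<open>ball_apart\<close> and \<open>ball_inside\<close>. These imply the set-theoretic relations,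
  are c.e., and hold for all sufficiently small balls around the relevant points, so that
  compactness turns them into conditions on finite covers.\<close>

abbreviation pfst :: "nat \<Rightarrow> nat" where "pfst z \<equiv> fst (prod_decode z)"
abbreviation psnd :: "nat \<Rightarrow> nat" where "psnd z \<equiv> snd (prod_decode z)"

subsection \<open>Total recursive functions\<close>

definition recursive_in :: "nat set \<Rightarrow> (nat \<Rightarrow> nat) \<Rightarrow> bool" where
  "recursive_in Z h \<longleftrightarrow> partial_recursive_in Z (\<lambda>n. Some (h n))"

named_theorems recursive_intros

lemma recursive_id [recursive_intros]: "recursive_in Z (\<lambda>x. x)"
  unfolding recursive_in_def
  using partial_recursive_in.pair[OF partial_recursive_in.left partial_recursive_in.right]
  by simp

lemma recursive_comp:
  assumes "recursive_in Z f" "recursive_in Z g"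
  shows "recursive_in Z (\<lambda>x. f (g x))"
  using partial_recursive_in.comp[of Z "\<lambda>x. Some (f x)" "\<lambda>x. Some (g x)"] assms
  by (simp add: recursive_in_def)

lemma recursive_Suc [recursive_intros]:
  "recursive_in Z f \<Longrightarrow> recursive_in Z (\<lambda>x. Suc (f x))"
  by (rule recursive_comp[of _ Suc]) (simp_all add: recursive_in_def partial_recursive_in.succ)

lemma recursive_const [recursive_intros]: "recursive_in Z (\<lambda>x. c)"
  by (induction c) (simp add: recursive_in_def partial_recursive_in.zero, erule recursive_Suc)

lemma recursive_pfst [recursive_intros]:
  "recursive_in Z f \<Longrightarrow> recursive_in Z (\<lambda>x. pfst (f x))"
  by (rule recursive_comp[of _ pfst]) (simp_all add: recursive_in_def partial_recursive_in.left)

lemma recursive_psnd [recursive_intros]: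
  "recursive_in Z f \<Longrightarrow> recursive_in Z (\<lambda>x. psnd (f x))"
  by (rule recursive_comp[of _ psnd]) (simp_all add: recursive_in_def partial_recursive_in.right)

lemma recursive_pair [recursive_intros]:
  assumes "recursive_in Z f" "recursive_in Z g"
  shows "recursive_in Z (\<lambda>x. prod_encode (f x, g x))"
  using partial_recursive_in.pair[of Z "\<lambda>x. Some (f x)" "\<lambda>x. Some (g x)"] assms
  by (simp add: recursive_in_def)

text \<open>The scheme \<open>rec\<close> receives parameter and counter as one coded number; hence
  the step function has to be recursive in the triple coding parameter, counter and previous
  value.\<close>

lemma recursive_rec_nat [recursive_intros]:
  assumes f: "recursive_in Z f"
    and g: "recursive_in Z (\<lambda>z. g (pfst z) (pfst (psnd z)) (psnd (psnd z)))"
    and k: "recursive_in Z k"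
  shows "recursive_in Z (\<lambda>x. rec_nat (f x) (g x) (k x))"
proof -
  let ?h = "\<lambda>z. rec_nat (f (pfst z)) (g (pfst z)) (psnd z)"
  have *: "rec_nat (Some (f a)) (\<lambda>j r. Option.bind r (\<lambda>v. Some (g a j v))) n
      = Some (rec_nat (f a) (g a) n)" for a n
    by (induction n) auto
  have "recursive_in Z ?h"
    using partial_recursive_in.rec[OF f[unfolded recursive_in_def] g[unfolded recursive_in_def]]
    by (simp add: recursive_in_def *)
  from recursive_comp[OF this recursive_pair[OF recursive_id k]] show ?thesis
    by simp
qed

lemma recursive_case_nat [recursive_intros]:
  assumes "recursive_in Z f" "recursive_in Z (\<lambda>z. g (pfst z) (psnd z))" "recursive_in Z k"
  shows "recursive_in Z (\<lambda>x. case k x of 0 \<Rightarrow> f x | Suc j \<Rightarrow> g x j)"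
proof -
  have "recursive_in Z (\<lambda>z. g (pfst z) (pfst (psnd z)))"
    using recursive_comp[OF assms(2), of "\<lambda>z. prod_encode (pfst z, pfst (psnd z))"]
    by (simp add: recursive_intros)
  then have "recursive_in Z (\<lambda>x. rec_nat (f x) (\<lambda>j _. g x j) (k x))"
    by (intro recursive_intros assms)
  moreover have "rec_nat a (\<lambda>j _. b j) n = (case n of 0 \<Rightarrow> a | Suc j \<Rightarrow> b j)"
    for a n :: nat and b
    by (cases n) auto
  ultimately show ?thesis by simp
qed

lemma recursive_if_zero [recursive_intros]:
  assumes "recursive_in Z f" "recursive_in Z g" "recursive_in Z k"
  shows "recursive_in Z (\<lambda>x. if k x = 0 then f x else g x)"
proof -
  have "recursive_in Z (\<lambda>x. case k x of 0 \<Rightarrow> f x | Suc j \<Rightarrow> g x)"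
    by (intro recursive_intros assms recursive_comp[OF assms(2)])
  moreover have "(case n of 0 \<Rightarrow> a | Suc _ \<Rightarrow> b) = (if n = 0 then a else b)" for n and a b :: nat
    by (cases n) auto
  ultimately show ?thesis by simp
qed

lemma recursive_add [recursive_intros]:
  assumes "recursive_in Z f" "recursive_in Z g"
  shows "recursive_in Z (\<lambda>x. f x + g x)"
proof -
  have "recursive_in Z (\<lambda>x. rec_nat (f x) (\<lambda>_ v. Suc v) (g x))"
    by (intro recursive_intros assms)
  moreover have "rec_nat a (\<lambda>_ v. Suc v) n = a + n" for a n
    by (induction n) auto
  ultimately show ?thesis by simp
qed

lemma recursive_mult [recursive_intros]:
  assumes "recursive_in Z f" "recursive_in Z g"
  shows "recursive_in Z (\<lambda>x. f x * g x)"
proof -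
  have "recursive_in Z (\<lambda>x. rec_nat 0 (\<lambda>_ v. f x + v) (g x))"
    by (intro recursive_intros assms recursive_comp[OF assms(1)])
  moreover have "rec_nat 0 (\<lambda>_ v. a + v) n = a * n" for a n :: nat
    by (induction n) auto
  ultimately show ?thesis by simp
qed

lemma recursive_diff [recursive_intros]:
  assumes "recursive_in Z f" "recursive_in Z g"
  shows "recursive_in Z (\<lambda>x. f x - g x)"
proof -
  have "recursive_in Z (\<lambda>x. rec_nat (f x) (\<lambda>_ v. case v of 0 \<Rightarrow> 0 | Suc w \<Rightarrow> w) (g x))"
    by (intro recursive_intros assms)
  moreover have "rec_nat a (\<lambda>_ v. case v of 0 \<Rightarrow> 0 | Suc w \<Rightarrow> w) n = a - n" for a n
    by (induction n) (auto split: nat.splits)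
  ultimately show ?thesis by simp
qed

subsection \<open>Normal form of recursively enumerable sets\<close>

text \<open>\<open>H n t = Suc v\<close> says that the computation of \<open>f\<close> on \<open>n\<close> has output \<open>v\<close> within \<open>t\<close> steps.\<close>

definition approximates :: "nat set \<Rightarrow> (nat \<Rightarrow> nat \<Rightarrow> nat) \<Rightarrow> (nat \<rightharpoonup> nat) \<Rightarrow> bool" where
  "approximates Z H f \<longleftrightarrow> recursive_in Z (\<lambda>z. H (pfst z) (psnd z)) \<and>
     (\<forall>n t t' v. H n t = Suc v \<longrightarrow> t \<le> t' \<longrightarrow> H n t' = Suc v) \<and>
     (\<forall>n v. f n = Some v \<longleftrightarrow> (\<exists>t. H n t = Suc v))"

lemma approximatesD:
  assumes "approximates Z H f"
  shows "recursive_in Z (\<lambda>z. H (pfst z) (psnd z))"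
    and "H n t = Suc v \<Longrightarrow> t \<le> t' \<Longrightarrow> H n t' = Suc v"
    and "f n = Some v \<longleftrightarrow> (\<exists>t. H n t = Suc v)"
    and "\<forall>n t t' v. H n t = Suc v \<longrightarrow> t \<le> t' \<longrightarrow> H n t' = Suc v"
  using assms unfolding approximates_def by blast+

text \<open>A result persists at all later stages, so computations that halt at different stages can
  be read off together at the maximum.\<close>

lemma common_stage:
  fixes F G :: "nat \<Rightarrow> nat \<Rightarrow> nat"
  assumes F: "\<forall>n t t' v. F n t = Suc v \<longrightarrow> t \<le> t' \<longrightarrow> F n t' = Suc v"
    and G: "\<forall>n t t' v. G n t = Suc v \<longrightarrow> t \<le> t' \<longrightarrow> G n t' = Suc v"
    and "F m s = Suc a" "G n t = Suc b"
  obtains r :: nat where "F m r = Suc a" "G n r = Suc b"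
proof
  show "F m (max s t) = Suc a" using F assms(3) max.cobounded1 by blast
  show "G n (max s t) = Suc b" using G assms(4) max.cobounded2 by blast
qed

lemma approximates_recursive:
  "recursive_in Z h \<Longrightarrow> approximates Z (\<lambda>n _. Suc (h n)) (\<lambda>n. Some (h n))"
  unfolding approximates_def by (auto intro: recursive_Suc recursive_comp[OF _ recursive_pfst[OF recursive_id]])

lemma recursive_approx:
  assumes "recursive_in Z (\<lambda>z. H (pfst z) (psnd z))" "recursive_in Z f" "recursive_in Z g"
  shows "recursive_in Z (\<lambda>x. H (f x) (g x))"
  using recursive_comp[OF assms(1) recursive_pair[OF assms(2,3)]] by simp

lemma approximates_pair:
  assumes F: "approximates Z F f" and G: "approximates Z G g"
  shows "approximates Z (\<lambda>n t. case F n t of 0 \<Rightarrow> 0 | Suc a \<Rightarrow>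
           (case G n t of 0 \<Rightarrow> 0 | Suc b \<Rightarrow> Suc (prod_encode (a, b))))
         (\<lambda>n. Option.bind (f n) (\<lambda>a. Option.bind (g n) (\<lambda>b. Some (prod_encode (a, b)))))"
    (is "approximates Z ?H ?h")
  unfolding approximates_def
proof (intro conjI allI impI)
  show "recursive_in Z (\<lambda>z. ?H (pfst z) (psnd z))"
    by (intro recursive_intros recursive_approx[OF approximatesD(1)[OF F]]
        recursive_approx[OF approximatesD(1)[OF G]])
  fix n t t' v assume "?H n t = Suc v" "t \<le> t'"
  then show "?H n t' = Suc v"
    using approximatesD(2)[OF F, of n t _ t'] approximatesD(2)[OF G, of n t _ t']
    by (auto split: nat.splits)
next
  fix n v
  show "?h n = Some v \<longleftrightarrow> (\<exists>t. ?H n t = Suc v)"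
  proof
    assume "?h n = Some v"
    then obtain a b where ab: "f n = Some a" "g n = Some b" "v = prod_encode (a, b)"
      by (auto simp: bind_eq_Some_conv)
    then obtain s t where "F n s = Suc a" "G n t = Suc b"
      using approximatesD(3)[OF F] approximatesD(3)[OF G] by blast
    then obtain r where "F n r = Suc a" "G n r = Suc b"
      by (rule common_stage[OF approximatesD(4)[OF F] approximatesD(4)[OF G]])
    then show "\<exists>t. ?H n t = Suc v"
      using ab by (intro exI[of _ r]) simp
  next
    assume "\<exists>t. ?H n t = Suc v"
    then obtain t where t: "?H n t = Suc v" by blast
    then obtain a where a: "F n t = Suc a" by (cases "F n t") auto
    with t obtain b where "G n t = Suc b" "v = prod_encode (a, b)" by (cases "G n t") auto
    moreover from this a have "f n = Some a" "g n = Some b"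
      using approximatesD(3)[OF F] approximatesD(3)[OF G] by blast+
    ultimately show "?h n = Some v" by simp
  qed
qed

lemma approximates_comp:
  assumes F: "approximates Z F f" and G: "approximates Z G g"
  shows "approximates Z (\<lambda>n t. case G n t of 0 \<Rightarrow> 0 | Suc a \<Rightarrow> F a t)
         (\<lambda>n. Option.bind (g n) f)"
    (is "approximates Z ?H ?h")
  unfolding approximates_def
proof (intro conjI allI impI)
  show "recursive_in Z (\<lambda>z. ?H (pfst z) (psnd z))"
    by (intro recursive_intros recursive_approx[OF approximatesD(1)[OF F]]
        recursive_approx[OF approximatesD(1)[OF G]])
  fix n t t' v assume "?H n t = Suc v" "t \<le> t'"
  then show "?H n t' = Suc v"
    using approximatesD(2)[OF F, of _ t _ t'] approximatesD(2)[OF G, of n t _ t']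
    by (auto split: nat.splits)
next
  fix n v
  show "?h n = Some v \<longleftrightarrow> (\<exists>t. ?H n t = Suc v)"
  proof
    assume "?h n = Some v"
    then obtain a where a: "g n = Some a" "f a = Some v"
      by (auto simp: bind_eq_Some_conv)
    then obtain s t where "F a s = Suc v" "G n t = Suc a"
      using approximatesD(3)[OF F] approximatesD(3)[OF G] by blast
    then obtain r where "F a r = Suc v" "G n r = Suc a"
      by (rule common_stage[OF approximatesD(4)[OF F] approximatesD(4)[OF G]])
    then show "\<exists>t. ?H n t = Suc v"
      by (intro exI[of _ r]) simp
  next
    assume "\<exists>t. ?H n t = Suc v"
    then obtain t where t: "?H n t = Suc v" by blast
    then obtain a where "G n t = Suc a" "F a t = Suc v" by (cases "G n t") auto
    then have "g n = Some a" "f a = Some v"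
      using approximatesD(3)[OF F] approximatesD(3)[OF G] by blast+
    then show "?h n = Some v" by simp
  qed
qed

lemma approximates_rec:
  assumes F: "approximates Z F f" and G: "approximates Z G g"
  shows "approximates Z (\<lambda>n t. rec_nat (F (pfst n) t) (\<lambda>k r. case r of 0 \<Rightarrow> 0
             | Suc v \<Rightarrow> G (prod_encode (pfst n, prod_encode (k, v))) t) (psnd n))
         (\<lambda>n. rec_nat (f (pfst n))
           (\<lambda>k r. Option.bind r (\<lambda>v. g (prod_encode (pfst n, prod_encode (k, v))))) (psnd n))"
proof -
  \<comment> \<open>Splitting the coded argument into \<open>a\<close> and \<open>m\<close> exposes
    the counter for induction. All rounds of the recursion share one time bound
    \<open>t\<close>.\<close>
  define H where "H a m t = rec_nat (F a t) (\<lambda>k r. case r of 0 \<Rightarrow> 0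
             | Suc v \<Rightarrow> G (prod_encode (a, prod_encode (k, v))) t) m" for a m t
  define h where "h a m = rec_nat (f a)
           (\<lambda>k r. Option.bind r (\<lambda>v. g (prod_encode (a, prod_encode (k, v))))) m" for a m
  have H_Suc: "H a (Suc m) t = Suc v \<longleftrightarrow>
      (\<exists>w. H a m t = Suc w \<and> G (prod_encode (a, prod_encode (m, w))) t = Suc v)" for a m t v
  proof -
    have "H a (Suc m) t = (case H a m t of 0 \<Rightarrow> 0
        | Suc w \<Rightarrow> G (prod_encode (a, prod_encode (m, w))) t)"
      by (simp add: H_def)
    then show ?thesis by (cases "H a m t") auto
  qed
  have H_mono: "H a m t = Suc v \<Longrightarrow> t \<le> t' \<Longrightarrow> H a m t' = Suc v" for a m t t' v
  proof (induction m arbitrary: v)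
    case 0
    then show ?case using approximatesD(2)[OF F, of a t v t'] by (simp add: H_def)
  next
    case (Suc m)
    then obtain w where w: "H a m t = Suc w" "G (prod_encode (a, prod_encode (m, w))) t = Suc v"
      unfolding H_Suc by blast
    then show ?case
      using Suc.IH[OF w(1) Suc.prems(2)] approximatesD(2)[OF G w(2) Suc.prems(2)]
      unfolding H_Suc by blast
  qed
  then have mono: "\<forall>m t t' v. H a m t = Suc v \<longrightarrow> t \<le> t' \<longrightarrow> H a m t' = Suc v" for a by blast
  have lim: "h a m = Some v \<longleftrightarrow> (\<exists>t. H a m t = Suc v)" for a m v
  proof (induction m arbitrary: v)
    case 0
    then show ?case using approximatesD(3)[OF F] by (simp add: H_def h_def)
  next
    case (Suc m)
    let ?p = "\<lambda>w. prod_encode (a, prod_encode (m, w))"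
    have "h a (Suc m) = Some v \<longleftrightarrow> (\<exists>w. h a m = Some w \<and> g (?p w) = Some v)"
      by (simp add: h_def bind_eq_Some_conv)
    also have "\<dots> \<longleftrightarrow> (\<exists>w s t. H a m s = Suc w \<and> G (?p w) t = Suc v)"
      using Suc.IH approximatesD(3)[OF G] by blast
    also have "\<dots> \<longleftrightarrow> (\<exists>w t. H a m t = Suc w \<and> G (?p w) t = Suc v)"
    proof
      assume "\<exists>w s t. H a m s = Suc w \<and> G (?p w) t = Suc v"
      then obtain w s t where "H a m s = Suc w" "G (?p w) t = Suc v" by blast
      then obtain r where "H a m r = Suc w" "G (?p w) r = Suc v"
        by (rule common_stage[OF mono approximatesD(4)[OF G]])
      then show "\<exists>w t. H a m t = Suc w \<and> G (?p w) t = Suc v" by blast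
    qed blast
    also have "\<dots> \<longleftrightarrow> (\<exists>t. H a (Suc m) t = Suc v)"
      unfolding H_Suc by blast
    finally show ?case .
  qed
  have "recursive_in Z (\<lambda>z. H (pfst (pfst z)) (psnd (pfst z)) (psnd z))"
    unfolding H_def by (intro recursive_intros recursive_approx[OF approximatesD(1)[OF F]]
        recursive_approx[OF approximatesD(1)[OF G]])
  then have "approximates Z (\<lambda>n t. H (pfst n) (psnd n) t) (\<lambda>n. h (pfst n) (psnd n))"
    unfolding approximates_def using mono lim by blast
  then show ?thesis by (simp only: H_def h_def)
qed

text \<open>The zero that witnesses convergence in the definition need not be the least one, but the
  least one lies at or below it. So all earlier values are defined, and nonzero by
  minimality.\<close>

lemma mu_eq_Some_iff:
  fixes f :: "nat \<Rightarrow> nat option"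
  shows "(if \<exists>k. f (prod_encode (a, k)) = Some 0 \<and> (\<forall>j<k. f (prod_encode (a, j)) \<noteq> None)
      then Some (LEAST k. f (prod_encode (a, k)) = Some 0) else None) = Some k \<longleftrightarrow>
    f (prod_encode (a, k)) = Some 0 \<and> (\<forall>j<k. \<exists>w. f (prod_encode (a, j)) = Some (Suc w))"
    (is "?h = Some k \<longleftrightarrow> ?Q")
proof
  assume h: "?h = Some k"
  then obtain k' where k': "f (prod_encode (a, k')) = Some 0" "\<forall>j<k'. f (prod_encode (a, j)) \<noteq> None"
    and k: "k = (LEAST k. f (prod_encode (a, k)) = Some 0)"
    by (auto split: if_splits)
  have z: "f (prod_encode (a, k)) = Some 0" unfolding k using k'(1) by (rule LeastI)
  have "k \<le> k'" unfolding k using k'(1) by (rule Least_le)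
  have "\<exists>w. f (prod_encode (a, j)) = Some (Suc w)" if "j < k" for j
  proof -
    have "f (prod_encode (a, j)) \<noteq> Some 0" using that unfolding k by (rule not_less_Least)
    moreover have "f (prod_encode (a, j)) \<noteq> None" using that \<open>k \<le> k'\<close> k'(2) by auto
    ultimately show ?thesis by (metis not0_implies_Suc option.exhaust)
  qed
  with z show ?Q by blast
next
  assume Q: ?Q
  then have "(LEAST k. f (prod_encode (a, k)) = Some 0) = k"
    by (intro Least_equality) (auto simp: not_less[symmetric])
  then show "?h = Some k" using Q by fastforce
qed

text \<open>The bounded search has to abort at the first value not yet known. Skipping it could
  report a zero that a later stage replaces by a smaller one, and an approximation must never change
  its output.\<close>

lemma approximates_mu:
  assumes F: "approximates Z F f"
  shows "\<exists>H. approximates Z H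
      (\<lambda>a. if \<exists>k. f (prod_encode (a, k)) = Some 0 \<and> (\<forall>j<k. f (prod_encode (a, j)) \<noteq> None)
           then Some (LEAST k. f (prod_encode (a, k)) = Some 0) else None)"
    (is "\<exists>H. approximates Z H ?h")
proof -
  let ?F = "\<lambda>a t k. F (prod_encode (a, k)) t"
  \<comment> \<open>0: still searching, 1: some value is undefined at stage \<open>t\<close>, \<open>k + 2\<close>: first zero found at \<open>k\<close>\<close>
  define R where "R a t m = rec_nat 0 (\<lambda>k r. case r of 0 \<Rightarrow>
      (case ?F a t k of 0 \<Rightarrow> 1 | Suc w \<Rightarrow> (case w of 0 \<Rightarrow> Suc (Suc k) | Suc _ \<Rightarrow> 0)) | Suc _ \<Rightarrow> r) m"
    for a t and m :: nat
  have R0: "R a t m = 0 \<longleftrightarrow> (\<forall>j<m. ?F a t j > 1)" for a t m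
    by (induction m) (auto simp: R_def less_Suc_eq split: nat.splits)
  have RS: "R a t m = Suc (Suc k) \<longleftrightarrow> k < m \<and> ?F a t k = 1 \<and> (\<forall>j<k. ?F a t j > 1)" for a t m k
  proof (induction m)
    case 0
    then show ?case by (simp add: R_def)
  next
    case (Suc m)
    show ?case
    proof (cases "R a t m = 0")
      case True
      then have lt: "\<forall>j<m. ?F a t j > 1" by (simp add: R0)
      have "R a t (Suc m) = (case ?F a t m of 0 \<Rightarrow> 1
           | Suc w \<Rightarrow> (case w of 0 \<Rightarrow> Suc (Suc m) | Suc _ \<Rightarrow> 0))"
        using True by (simp add: R_def)
      then show ?thesis using lt
        by (auto simp: less_Suc_eq split: nat.splits)
    next
      case False
      then have "R a t (Suc m) = R a t m" by (auto simp: R_def split: nat.splits)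
      moreover have "\<exists>j<m. ?F a t j \<le> 1" using False R0[of a t m] by (auto simp: not_less)
      ultimately show ?thesis using Suc.IH
        by (auto simp: less_Suc_eq dest: leD)
    qed
  qed
  \<comment> \<open>Subtracting 1 merges the searching and the aborted state into \<open>0\<close>
    and turns the code \<open>k + 2\<close> into \<open>Suc k\<close>. The stage also serves as the
    length of the search.\<close>
  have H: "R a t t - 1 = Suc k \<longleftrightarrow> k < t \<and> ?F a t k = 1 \<and> (\<forall>j<k. ?F a t j > 1)" for a t k
    unfolding RS[symmetric] by auto
  have up: "?F a t' k > 1" if "?F a t k > 1" "t \<le> t'" for a t t' k
    using that approximatesD(2)[OF F, of "prod_encode (a, k)" t _ t'] by (cases "?F a t k") auto
  have "approximates Z (\<lambda>a t. R a t t - 1) ?h"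
    unfolding approximates_def
  proof (intro conjI allI impI)
    show "recursive_in Z (\<lambda>z. R (pfst z) (psnd z) (psnd z) - 1)"
      unfolding R_def
      by (intro recursive_intros recursive_approx[OF approximatesD(1)[OF F]])
  next
    fix a t t' k assume "R a t t - 1 = Suc k" "t \<le> t'"
    then show "R a t' t' - 1 = Suc k"
      unfolding H using up[where a = a and t = t and t' = t'] approximatesD(2)[OF F, of _ t 0 t'] by auto
  next
    fix a k
    let ?Q = "f (prod_encode (a, k)) = Some 0 \<and> (\<forall>j<k. \<exists>w. f (prod_encode (a, j)) = Some (Suc w))"
    show "?h a = Some k \<longleftrightarrow> (\<exists>t. R a t t - 1 = Suc k)"
      unfolding mu_eq_Some_iff H
    proof
      assume Q: ?Q
      then obtain t0 where t0: "?F a t0 k = Suc 0" using approximatesD(3)[OF F] by blast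
      have "\<exists>t w. ?F a t j = Suc (Suc w)" if "j < k" for j
        using Q that approximatesD(3)[OF F] by blast
      then obtain s where s: "\<And>j. j < k \<Longrightarrow> ?F a (s j) j > 1"
        by (metis One_nat_def Suc_less_eq zero_less_Suc)
      \<comment> \<open>\<open>Suc k\<close> is included because the search at stage
        \<open>t\<close> inspects only arguments below \<open>t\<close>.\<close>
      define t where "t = Max (insert (Suc k) (insert t0 (s ` {..<k})))"
      have "t \<ge> Suc k" "t \<ge> t0" and st: "\<And>j. j < k \<Longrightarrow> s j \<le> t" 
        unfolding t_def by (intro Max_ge; simp)+
      then show "\<exists>t. k < t \<and> ?F a t k = 1 \<and> (\<forall>j<k. ?F a t j > 1)"
        using approximatesD(2)[OF F t0, of t] up[OF s st] by (intro exI[of _ t]) auto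
    next
      assume "\<exists>t. k < t \<and> ?F a t k = 1 \<and> (\<forall>j<k. ?F a t j > 1)"
      then obtain t where t: "?F a t k = Suc 0" "\<forall>j<k. ?F a t j > 1" by auto
      have "\<exists>w. f (prod_encode (a, j)) = Some (Suc w)" if "j < k" for j
      proof -
        have "?F a t j = Suc (Suc (?F a t j - 2))" using t(2) that by fastforce
        then show ?thesis using approximatesD(3)[OF F] by blast
      qed
      then show ?Q using t(1) approximatesD(3)[OF F] by blast
    qed
  qed
  then show ?thesis by blast
qed

lemma partial_recursive_approximable:
  "partial_recursive_in Z f \<Longrightarrow> \<exists>H. approximates Z H f"
proof (induction rule: partial_recursive_in.induct)
  case (mu f)
  then show ?case using approximates_mu by blast
qed (use approximates_pair approximates_comp approximates_rec in
    \<open>fastforce intro: approximates_recursive simp: recursive_in_def intro: partial_recursive_in.intros\<close>)+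

text \<open>A total approximation turns the domain into the projection of a recursive relation.
  Truth is coded by \<open>0\<close> so that \<open>mu\<close> gives the set back: on a total
  function its convergence condition is automatic.\<close>

lemma ce_in_iff:
  "ce_in Z S \<longleftrightarrow>
    (\<exists>H. recursive_in Z (\<lambda>z. H (pfst z) (psnd z)) \<and> S = {n. \<exists>t. H n t = 0})"
proof
  assume "ce_in Z S"
  then obtain f H where S: "S = dom f" and H: "approximates Z H f"
    using partial_recursive_approximable unfolding ce_in_def by blast
  have "S = {n. \<exists>t. (1::nat) - H n t = 0}"
    unfolding S dom_def using approximatesD(3)[OF H] by (auto simp: Suc_le_eq gr0_conv_Suc)
  moreover have "recursive_in Z (\<lambda>z. 1 - H (pfst z) (psnd z))"
    by (intro recursive_intros approximatesD(1)[OF H])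
  ultimately show "\<exists>H. recursive_in Z (\<lambda>z. H (pfst z) (psnd z)) \<and> S = {n. \<exists>t. H n t = 0}"
    by (intro exI[of _ "\<lambda>n t. 1 - H n t"]) auto
next
  assume "\<exists>H. recursive_in Z (\<lambda>z. H (pfst z) (psnd z)) \<and> S = {n. \<exists>t. H n t = 0}"
  then obtain H where H: "recursive_in Z (\<lambda>z. H (pfst z) (psnd z))" and S: "S = {n. \<exists>t. H n t = 0}"
    by blast
  from partial_recursive_in.mu[OF H[unfolded recursive_in_def]] show "ce_in Z S"
    unfolding ce_in_def S by (intro exI conjI, assumption) (auto split: if_splits)
qed

lemma ce_inI:
  "recursive_in Z (\<lambda>z. H (pfst z) (psnd z)) \<Longrightarrow> (\<And>n. P n \<longleftrightarrow> (\<exists>t. H n t = 0)) \<Longrightarrow>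
    ce_in Z {n. P n}"
  by (auto simp: ce_in_iff)

section \<open>Closure properties of recursively enumerable sets\<close>

named_theorems ce_intros

lemma ce_mem [ce_intros]:
  assumes "ce_in Z S" "recursive_in Z f"
  shows "ce_in Z {x. f x \<in> S}"
proof -
  obtain H where H: "recursive_in Z (\<lambda>z. H (pfst z) (psnd z))" "S = {n. \<exists>t. H n t = 0}"
    using assms(1) by (auto simp: ce_in_iff)
  show ?thesis
    by (rule ce_inI[of _ "\<lambda>x t. H (f x) t"])
       (auto simp: H(2) intro!: recursive_approx[OF H(1)] recursive_intros recursive_comp[OF assms(2)])
qed

lemma ce_Collect:
  assumes "ce_in Z {x. P x}" "recursive_in Z f"
  shows "ce_in Z {x. P (f x)}"
  using ce_mem[OF assms] by simp

lemma ce_conj [ce_intros]: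
  assumes "ce_in Z {x. P x}" "ce_in Z {x. Q x}"
  shows "ce_in Z {x. P x \<and> Q x}"
proof -
  obtain F where F: "recursive_in Z (\<lambda>z. F (pfst z) (psnd z))" "{x. P x} = {n. \<exists>t. F n t = 0}"
    using assms(1) by (auto simp: ce_in_iff)
  obtain G where G: "recursive_in Z (\<lambda>z. G (pfst z) (psnd z))" "{x. Q x} = {n. \<exists>t. G n t = 0}"
    using assms(2) by (auto simp: ce_in_iff)
  show ?thesis
  proof (rule ce_inI)
    show "recursive_in Z (\<lambda>z. F (pfst z) (pfst (psnd z)) + G (pfst z) (psnd (psnd z)))"
      by (intro recursive_intros recursive_approx[OF F(1)] recursive_approx[OF G(1)])
    fix n
    show "P n \<and> Q n \<longleftrightarrow> (\<exists>t. F n (pfst t) + G n (psnd t) = 0)"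
      using F(2) G(2) by (auto simp: set_eq_iff) (metis fst_conv snd_conv prod_encode_inverse)
  qed
qed

lemma ce_disj [ce_intros]:
  assumes "ce_in Z {x. P x}" "ce_in Z {x. Q x}"
  shows "ce_in Z {x. P x \<or> Q x}"
proof -
  obtain F where F: "recursive_in Z (\<lambda>z. F (pfst z) (psnd z))" "{x. P x} = {n. \<exists>t. F n t = 0}"
    using assms(1) by (auto simp: ce_in_iff)
  obtain G where G: "recursive_in Z (\<lambda>z. G (pfst z) (psnd z))" "{x. Q x} = {n. \<exists>t. G n t = 0}"
    using assms(2) by (auto simp: ce_in_iff)
  show ?thesis
  proof (rule ce_inI)
    show "recursive_in Z (\<lambda>z. F (pfst z) (psnd z) * G (pfst z) (psnd z))"
      by (intro recursive_intros recursive_approx[OF F(1)] recursive_approx[OF G(1)])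
    fix n
    show "P n \<or> Q n \<longleftrightarrow> (\<exists>t. F n t * G n t = 0)"
      using F(2) G(2) by (auto simp: set_eq_iff)
  qed
qed

lemma ce_ex [ce_intros]:
  assumes "ce_in Z {z. P (pfst z) (psnd z)}"
  shows "ce_in Z {x. \<exists>y. P x y}"
proof -
  obtain F where F: "recursive_in Z (\<lambda>z. F (pfst z) (psnd z))"
      "{z. P (pfst z) (psnd z)} = {n. \<exists>t. F n t = 0}"
    using assms(1) by (auto simp: ce_in_iff)
  have P: "P x y \<longleftrightarrow> (\<exists>t. F (prod_encode (x, y)) t = 0)" for x y
    using F(2) by (auto simp: set_eq_iff dest: spec[of _ "prod_encode (x, y)"])
  show ?thesis
  proof (rule ce_inI)
    show "recursive_in Z (\<lambda>z. F (prod_encode (pfst z, pfst (psnd z))) (psnd (psnd z)))"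
      by (intro recursive_intros recursive_approx[OF F(1)])
    fix n
    show "(\<exists>y. P n y) \<longleftrightarrow> (\<exists>t. F (prod_encode (n, pfst t)) (psnd t) = 0)"
      unfolding P by (metis fst_conv snd_conv prod_encode_inverse)
  qed
qed

lemma ce_le [ce_intros]:
  assumes "recursive_in Z f" "recursive_in Z g"
  shows "ce_in Z {x. f x \<le> g x}"
  by (rule ce_inI[of _ "\<lambda>n _. f n - g n"])
     (auto intro!: recursive_intros recursive_comp[OF assms(1)] recursive_comp[OF assms(2)])

lemma ce_less [ce_intros]:
  assumes "recursive_in Z f" "recursive_in Z g"
  shows "ce_in Z {x. f x < g x}"
  using ce_le[OF recursive_Suc[OF assms(1)] assms(2)] by (simp add: Suc_le_eq)

lemma ce_eq [ce_intros]:
  assumes "recursive_in Z f" "recursive_in Z g"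
  shows "ce_in Z {x. f x = g x}"
  using ce_conj[OF ce_le[OF assms] ce_le[OF assms(2,1)]] by (simp add: eq_iff)

lemma ce_neq [ce_intros]:
  assumes "recursive_in Z f" "recursive_in Z g"
  shows "ce_in Z {x. f x \<noteq> g x}"
  using ce_disj[OF ce_less[OF assms] ce_less[OF assms(2,1)]] by (simp add: neq_iff)

text \<open>Relative to the empty set a query always returns \<open>0\<close>, a constant available
  with every oracle.\<close>

lemma partial_recursive_in_mono:
  "partial_recursive_in {} f \<Longrightarrow> partial_recursive_in Z f"
proof (induction rule: partial_recursive_in.induct)
  case query
  then show ?case using partial_recursive_in.zero by simp
qed (rule partial_recursive_in.intros; assumption)+

lemma ce_imp_ce_in: "ce S \<Longrightarrow> ce_in Z S"
  unfolding ce_in_def using partial_recursive_in_mono by blast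

section \<open>Reachability, derivations and coded lists\<close>

lemma ce_Collect2:
  assumes "ce_in Z {z. P (pfst z) (psnd z)}" "recursive_in Z f" "recursive_in Z g"
  shows "ce_in Z {x. P (f x) (g x)}"
  using ce_Collect[OF assms(1) recursive_pair[OF assms(2,3)]] by simp

text \<open>The length and the moves of a path are guessed in advance and replayed by primitive
  recursion. An invalid move leaves the point in place, so no guess leads to an unreachable
  point.\<close>

lemma ce_rtranclp:
  assumes R: "ce_in Z {z. R (pfst z) (psnd z)}"
    and f: "recursive_in Z f" and g: "recursive_in Z g"
  shows "ce_in Z {x. R\<^sup>*\<^sup>* (f x) (g x)}"
proof -
  obtain H where H: "recursive_in Z (\<lambda>z. H (pfst z) (psnd z))"
      "{z. R (pfst z) (psnd z)} = {n. \<exists>t. H n t = 0}"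
    using R by (auto simp: ce_in_iff)
  have R_iff: "R a b \<longleftrightarrow> (\<exists>t. H (prod_encode (a, b)) t = 0)" for a b
    using H(2) by (auto simp: set_eq_iff dest: spec[of _ "prod_encode (a, b)"])
  \<comment> \<open>A state pairs the current point with a coded supply of attempted moves \<open>(target, witness)\<close>.\<close>
  define step where "step s = (if H (prod_encode (pfst s, pfst (pfst (psnd s)))) (psnd (pfst (psnd s))) = 0
      then prod_encode (pfst (pfst (psnd s)), psnd (psnd s))
      else prod_encode (pfst s, psnd (psnd s)))" for s
  define run where "run s k = rec_nat s (\<lambda>_. step) k" for s k
  have step_rec: "recursive_in Z step"
    unfolding step_def by (intro recursive_intros recursive_approx[OF H(1)])
  have run_0: "run s 0 = s" and run_Suc: "run s (Suc k) = step (run s k)" for s k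
    by (simp_all add: run_def)
  have run_shift: "run s (Suc k) = run (step s) k" for s k
    by (induction k) (simp_all add: run_0 run_Suc)
  have "R (pfst s) (pfst (step s)) \<or> pfst (step s) = pfst s" for s
    by (auto simp: step_def R_iff)
  then have sound: "R\<^sup>*\<^sup>* (pfst s) (pfst (run s k))" for s k
    by (induction k) (auto simp: run_0 run_Suc intro: rtranclp.rtrancl_into_rtrancl, metis rtranclp.rtrancl_into_rtrancl)
  have complete: "\<exists>w k. pfst (run (prod_encode (a, w)) k) = b" if "R\<^sup>*\<^sup>* a b" for a b
    using that
  proof (induction rule: converse_rtranclp_induct)
    case base
    show ?case by (intro exI[of _ 0]) (simp add: run_0)
  next
    case (step a a')
    then obtain w k t where w: "pfst (run (prod_encode (a', w)) k) = b"
      and t: "H (prod_encode (a, a')) t = 0"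
      using R_iff by blast
    have "step (prod_encode (a, prod_encode (prod_encode (a', t), w))) = prod_encode (a', w)"
      using t by (simp add: step_def)
    with w have "pfst (run (prod_encode (a, prod_encode (prod_encode (a', t), w))) (Suc k)) = b"
      by (simp only: run_shift)
    then show ?case by blast
  qed
  have "ce_in Z {x. \<exists>w k. pfst (run (prod_encode (f x, w)) k) = g x}"
    unfolding run_def
    by (intro ce_intros recursive_intros recursive_comp[OF f] recursive_comp[OF g]
        recursive_comp[OF step_rec])
  moreover have "(\<exists>w k. pfst (run (prod_encode (a, w)) k) = b) \<longleftrightarrow> R\<^sup>*\<^sup>* a b" for a b
    using sound[of "prod_encode (a, _)"] complete by auto
  ultimately show ?thesis by simp
qed

text \<open>A generic format for inductive predicates on codes, into which \<open>ev\<close> and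
  \<open>rat_dist\<close> are translated. Every rule has exactly two premises; a rule with a single
  premise lists it twice.\<close>

inductive derivable :: "nat set \<Rightarrow> nat set \<Rightarrow> nat \<Rightarrow> bool" for A T where
  axiom: "x \<in> A \<Longrightarrow> derivable A T x"
| step: "prod_encode (x, prod_encode (p, q)) \<in> T \<Longrightarrow> derivable A T p \<Longrightarrow> derivable A T q \<Longrightarrow>
    derivable A T x"

text \<open>Proof search with a stack of open goals, coded as a list.\<close>

lemma ce_derivable:
  assumes A: "ce_in Z A" and T: "ce_in Z T" and f: "recursive_in Z f"
  shows "ce_in Z {x. derivable A T (f x)}"
proof -
  \<comment> \<open>\<open>Suc (prod_encode (x, L))\<close> codes the list with head
    \<open>x\<close> and tail code \<open>L\<close>; \<open>0\<close> is the stack without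
    goals.\<close>
  define R where "R s s' \<longleftrightarrow> (\<exists>x L. s = Suc (prod_encode (x, L)) \<and> (x \<in> A \<and> s' = L \<or>
      (\<exists>p q. prod_encode (x, prod_encode (p, q)) \<in> T \<and>
        s' = Suc (prod_encode (p, Suc (prod_encode (q, L)))))))" for s s'
  have R: "ce_in Z {z. R (pfst z) (psnd z)}"
    unfolding R_def by (intro ce_intros recursive_intros A T)
  have sound: "\<forall>x\<in>set (list_decode s). derivable A T x" if "R\<^sup>*\<^sup>* s 0" for s
    using that
  proof (induction rule: converse_rtranclp_induct)
    case (step s s')
    then show ?case by (auto simp: R_def intro: derivable.intros)
  qed simp
  \<comment> \<open>The rest \<open>L\<close> of the stack is arbitrary, so that the goal
    \<open>q\<close> can wait below while \<open>p\<close> is being discharged.\<close>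
  have complete: "R\<^sup>*\<^sup>* (Suc (prod_encode (x, L))) L" if "derivable A T x" for x L
    using that
  proof (induction arbitrary: L)
    case (axiom x)
    then show ?case by (intro r_into_rtranclp) (auto simp: R_def)
  next
    case (step x p q)
    have "R (Suc (prod_encode (x, L))) (Suc (prod_encode (p, Suc (prod_encode (q, L)))))"
      unfolding R_def using step.hyps(1) by blast
    then show ?case
      using step.IH(1)[of "Suc (prod_encode (q, L))"] step.IH(2)[of L]
      by (meson converse_rtranclp_into_rtranclp rtranclp_trans)
  qed
  have "derivable A T x \<longleftrightarrow> R\<^sup>*\<^sup>* (Suc (prod_encode (x, 0))) 0" for x
    using sound[of "Suc (prod_encode (x, 0))"] complete by auto
  then show ?thesis
    by (simp only:) (intro ce_rtranclp R recursive_intros f)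
qed

text \<open>The universal quantifier is unwound by walking along the list, one checked entry per
  move; the parameter travels with the remaining list.\<close>

lemma ce_list_all [ce_intros]:
  assumes P: "ce_in Z {z. P (pfst z) (psnd z)}" and f: "recursive_in Z f"
  shows "ce_in Z {x. \<forall>y\<in>set (list_decode (f x)). P x y}"
proof -
  define R where "R s s' \<longleftrightarrow> (\<exists>y L. pfst s = Suc (prod_encode (y, L)) \<and> P (psnd s) y \<and>
      s' = prod_encode (L, psnd s))" for s s'
  have R: "ce_in Z {z. R (pfst z) (psnd z)}"
    unfolding R_def by (intro ce_intros recursive_intros ce_Collect2[OF P])
  have sound: "\<forall>y\<in>set (list_decode (pfst s)). P x y"
    if "R\<^sup>*\<^sup>* s (prod_encode (0, x))" "psnd s = x" for s x
    using that by (induction rule: converse_rtranclp_induct) (auto simp: R_def)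
  have complete: "R\<^sup>*\<^sup>* (prod_encode (list_encode l, x)) (prod_encode (0, x))"
    if "\<forall>y\<in>set l. P x y" for l x
    using that
  proof (induction l)
    case (Cons y l)
    then have "R (prod_encode (list_encode (y # l), x)) (prod_encode (list_encode l, x))"
      by (auto simp: R_def)
    with Cons show ?case by (auto intro: converse_rtranclp_into_rtranclp)
  qed simp
  have "(\<forall>y\<in>set (list_decode l). P x y) \<longleftrightarrow> R\<^sup>*\<^sup>* (prod_encode (l, x)) (prod_encode (0, x))" for l x
    using sound[of "prod_encode (l, x)" x] complete[of "list_decode l" x] by auto
  then show ?thesis
    by (simp only:) (intro ce_rtranclp R recursive_intros f)
qed

lemma ce_list_member [ce_intros]:
  assumes f: "recursive_in Z f" and g: "recursive_in Z g"
  shows "ce_in Z {x. g x \<in> set (list_decode (f x))}"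
proof -
  define R where "R s s' \<longleftrightarrow> (\<exists>y. s = Suc (prod_encode (y, s')))" for s s'
  have R: "ce_in Z {z. R (pfst z) (psnd z)}"
    unfolding R_def by (intro ce_intros recursive_intros)
  have sound: "y \<in> set (list_decode s)" if "R\<^sup>*\<^sup>* s (Suc (prod_encode (y, L)))" for s y L
    using that by (induction rule: converse_rtranclp_induct) (auto simp: R_def)
  have complete: "\<exists>L. R\<^sup>*\<^sup>* (list_encode l) (Suc (prod_encode (y, L)))" if "y \<in> set l" for l y
    using that
  proof (induction l)
    case (Cons x l)
    then show ?case
    proof (cases "x = y")
      case False
      then obtain L where "R\<^sup>*\<^sup>* (list_encode l) (Suc (prod_encode (y, L)))"
        using Cons by auto
      moreover have "R (list_encode (x # l)) (list_encode l)" by (auto simp: R_def)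
      ultimately show ?thesis by (blast intro: converse_rtranclp_into_rtranclp)
    qed auto
  qed simp
  have "y \<in> set (list_decode s) \<longleftrightarrow> (\<exists>L. R\<^sup>*\<^sup>* s (Suc (prod_encode (y, L))))" for s y
    using sound complete[of y "list_decode s"] by auto
  then show ?thesis
    by (simp only:) (intro ce_ex ce_rtranclp R recursive_intros recursive_comp[OF f] recursive_comp[OF g])
qed

lemma ce_list_ex [ce_intros]:
  assumes P: "ce_in Z {z. P (pfst z) (psnd z)}" and f: "recursive_in Z f"
  shows "ce_in Z {x. \<exists>y\<in>set (list_decode (f x)). P x y}"
  unfolding Bex_def
  by (intro ce_intros recursive_intros recursive_comp[OF f] P)

text \<open>The bound is part of the statement because \<open>!\<close> is unspecified beyond the
  end of a list. The walk drops entries while counting the index down to 0.\<close>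

lemma ce_nth [ce_intros]:
  assumes i: "recursive_in Z i" and f: "recursive_in Z f" and g: "recursive_in Z g"
  shows "ce_in Z {x. i x < length (list_decode (f x)) \<and> list_decode (f x) ! i x = g x}"
proof -
  define R where "R s s' \<longleftrightarrow>
      (\<exists>k y L. s = prod_encode (Suc k, Suc (prod_encode (y, L))) \<and> s' = prod_encode (k, L))" for s s'
  have R: "ce_in Z {z. R (pfst z) (psnd z)}"
    unfolding R_def by (intro ce_intros recursive_intros)
  have sound: "pfst s < length (list_decode (psnd s)) \<and> list_decode (psnd s) ! pfst s = y"
    if "R\<^sup>*\<^sup>* s (prod_encode (0, Suc (prod_encode (y, L))))" for s y L
    using that by (induction rule: converse_rtranclp_induct) (auto simp: R_def)
  have complete: "\<exists>L. R\<^sup>*\<^sup>* (prod_encode (k, list_encode l)) (prod_encode (0, Suc (prod_encode (l ! k, L))))"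
    if "k < length l" for k l
    using that
  proof (induction l arbitrary: k)
    case (Cons x l)
    then show ?case
    proof (cases k)
      case (Suc j)
      then obtain L where
        "R\<^sup>*\<^sup>* (prod_encode (j, list_encode l)) (prod_encode (0, Suc (prod_encode (l ! j, L))))"
        using Cons by auto
      moreover have "R (prod_encode (k, list_encode (x # l))) (prod_encode (j, list_encode l))"
        by (auto simp: R_def Suc)
      ultimately show ?thesis using Suc
        by (auto intro: converse_rtranclp_into_rtranclp)
    qed auto
  qed simp
  have "k < length (list_decode s) \<and> list_decode s ! k = y \<longleftrightarrow>
      (\<exists>L. R\<^sup>*\<^sup>* (prod_encode (k, s)) (prod_encode (0, Suc (prod_encode (y, L)))))" for k s y
    using sound[of "prod_encode (k, s)" y] complete[of k "list_decode s"] by auto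
  then show ?thesis
    by (simp only:) (intro ce_ex ce_rtranclp R recursive_intros
        recursive_comp[OF i] recursive_comp[OF f] recursive_comp[OF g])
qed

subsection \<open>A universal recursively enumerable set\<close>

text \<open>The first component of a code selects the scheme. Unlike in \<^const>\<open>partial_recursive_in\<close>,
  minimisation takes the point from which the search starts as part of its input.\<close>

inductive ev :: "(nat \<Rightarrow> nat \<Rightarrow> bool) \<Rightarrow> nat \<Rightarrow> nat \<Rightarrow> nat \<Rightarrow> bool" for Q where
  zero: "ev Q (prod_encode (0, c)) n 0"
| succ: "ev Q (prod_encode (1, c)) n (Suc n)"
| left: "ev Q (prod_encode (2, c)) n (pfst n)"
| right: "ev Q (prod_encode (3, c)) n (psnd n)"
| query: "Q n r \<Longrightarrow> ev Q (prod_encode (4, c)) n r"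
| pair: "ev Q c n a \<Longrightarrow> ev Q d n b \<Longrightarrow>
    ev Q (prod_encode (5, prod_encode (c, d))) n (prod_encode (a, b))"
| comp: "ev Q d n a \<Longrightarrow> ev Q c a v \<Longrightarrow> ev Q (prod_encode (6, prod_encode (c, d))) n v"
| rec_0: "ev Q c a v \<Longrightarrow> ev Q (prod_encode (7, prod_encode (c, d))) (prod_encode (a, 0)) v"
| rec_Suc: "ev Q (prod_encode (7, prod_encode (c, d))) (prod_encode (a, k)) w \<Longrightarrow>
    ev Q d (prod_encode (a, prod_encode (k, w))) v \<Longrightarrow>
    ev Q (prod_encode (7, prod_encode (c, d))) (prod_encode (a, Suc k)) v"
| mu_0: "ev Q c (prod_encode (a, k)) 0 \<Longrightarrow> ev Q (prod_encode (8, c)) (prod_encode (a, k)) k"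
| mu_Suc: "ev Q c (prod_encode (a, k)) (Suc w) \<Longrightarrow>
    ev Q (prod_encode (8, c)) (prod_encode (a, Suc k)) v \<Longrightarrow>
    ev Q (prod_encode (8, c)) (prod_encode (a, k)) v"

lemma ev_simps:
  "ev Q (prod_encode (0, c)) n v \<longleftrightarrow> v = 0"
  "ev Q (prod_encode (Suc 0, c)) n v \<longleftrightarrow> v = Suc n"
  "ev Q (prod_encode (2, c)) n v \<longleftrightarrow> v = pfst n"
  "ev Q (prod_encode (3, c)) n v \<longleftrightarrow> v = psnd n"
  "ev Q (prod_encode (4, c)) n v \<longleftrightarrow> Q n v"
  "ev Q (prod_encode (5, prod_encode (c, d))) n v \<longleftrightarrow>
     (\<exists>a b. v = prod_encode (a, b) \<and> ev Q c n a \<and> ev Q d n b)"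
  "ev Q (prod_encode (6, prod_encode (c, d))) n v \<longleftrightarrow> (\<exists>a. ev Q d n a \<and> ev Q c a v)"
  "ev Q (prod_encode (7, prod_encode (c, d))) (prod_encode (a, 0)) v \<longleftrightarrow> ev Q c a v"
  "ev Q (prod_encode (7, prod_encode (c, d))) (prod_encode (a, Suc k)) v \<longleftrightarrow>
     (\<exists>w. ev Q (prod_encode (7, prod_encode (c, d))) (prod_encode (a, k)) w \<and>
          ev Q d (prod_encode (a, prod_encode (k, w))) v)"
  by (subst ev.simps, force)+

text \<open>\<open>ev\<close> takes its oracle as a relation so that total oracles and their finite,
  partial approximations fit into the same evaluation.\<close>

definition oracle_graph :: "nat set \<Rightarrow> nat \<Rightarrow> nat \<Rightarrow> bool" where
  "oracle_graph Z n r \<longleftrightarrow> r = (if n \<in> Z then 1 else 0)"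

text \<open>At \<open>k = 0\<close> the right side is the criterion of
  \<open>mu_eq_Some_iff\<close>. A general start point is needed because each unsuccessful test
  moves it up by one: one direction follows the evaluation, the other descends from \<open>v\<close>
  to \<open>k\<close>.\<close>

lemma ev_mu_iff:
  assumes f: "\<And>n v. f n = Some v \<longleftrightarrow> ev Q c n v"
  shows "ev Q (prod_encode (8, c)) (prod_encode (a, k)) v \<longleftrightarrow>
    k \<le> v \<and> f (prod_encode (a, v)) = Some 0 \<and>
    (\<forall>j. k \<le> j \<and> j < v \<longrightarrow> (\<exists>w. f (prod_encode (a, j)) = Some (Suc w)))"
    (is "?L k \<longleftrightarrow> ?R k")
proof
  assume "?L k"
  then show "?R k"
  proof (induction "prod_encode (8, c)" "prod_encode (a, k)" v arbitrary: k rule: ev.induct)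
    case (mu_0 c' a' k')
    then show ?case by (auto simp: f)
  next
    case (mu_Suc c' a' k' w v)
    then have eq: "c' = c" "a' = a" "k' = k" by simp_all
    have "f (prod_encode (a, k)) = Some (Suc w)" using mu_Suc.hyps(1) by (simp add: f eq)
    moreover have "Suc k \<le> v \<and> f (prod_encode (a, v)) = Some 0 \<and>
        (\<forall>j. Suc k \<le> j \<and> j < v \<longrightarrow> (\<exists>w. f (prod_encode (a, j)) = Some (Suc w)))"
      using mu_Suc.hyps(4) by (simp add: eq)
    moreover have "j = k \<or> Suc k \<le> j" if "k \<le> j" for j using that by auto
    ultimately show ?case by (metis Suc_leD)
  qed simp_all
next
  assume R: "?R k"
  then have "k \<le> v" by simp
  then show "?L k" using R
  proof (induction rule: inc_induct)
    case base
    then show ?case by (auto simp: f intro: ev.mu_0)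
  next
    case (step n)
    then obtain w where "ev Q c (prod_encode (a, n)) (Suc w)" by (auto simp: f)
    moreover have "?L (Suc n)" using step by auto
    ultimately show ?case by (rule ev.mu_Suc)
  qed
qed

text \<open>Without an oracle the query can be replaced by the constant zero function, hence the first
  alternative.\<close>

definition code_for :: "nat set \<Rightarrow> (nat \<rightharpoonup> nat) \<Rightarrow> nat \<Rightarrow> bool" where
  "code_for Z f c \<longleftrightarrow>
    (\<forall>Q. Z = {} \<or> Q = oracle_graph Z \<longrightarrow> (\<forall>n v. f n = Some v \<longleftrightarrow> ev Q c n v))"

lemma code_forI:
  "(\<And>Q n v. Z = {} \<or> Q = oracle_graph Z \<Longrightarrow> f n = Some v \<longleftrightarrow> ev Q c n v) \<Longrightarrow> code_for Z f c"
  by (simp add: code_for_def)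

lemma code_forD:
  "code_for Z f c \<Longrightarrow> Z = {} \<or> Q = oracle_graph Z \<Longrightarrow> f n = Some v \<longleftrightarrow> ev Q c n v"
  unfolding code_for_def by blast

lemma partial_recursive_code:
  "partial_recursive_in Z f \<Longrightarrow> \<exists>c. code_for Z f c"
proof (induction rule: partial_recursive_in.induct)
  case zero
  have "code_for Z (\<lambda>_. Some 0) (prod_encode (0, 0))"
    by (rule code_forI) (auto simp: ev_simps)
  then show ?case ..
next
  case succ
  have "code_for Z (\<lambda>n. Some (Suc n)) (prod_encode (1, 0))"
    by (rule code_forI) (auto simp: ev_simps)
  then show ?case ..
next
  case left
  have "code_for Z (\<lambda>n. Some (pfst n)) (prod_encode (2, 0))"
    by (rule code_forI) (auto simp: ev_simps)
  then show ?case ..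
next
  case right
  have "code_for Z (\<lambda>n. Some (psnd n)) (prod_encode (3, 0))"
    by (rule code_forI) (auto simp: ev_simps)
  then show ?case ..
next
  case query
  have "code_for Z (\<lambda>n. Some (if n \<in> Z then 1 else 0)) (prod_encode (if Z = {} then 0 else 4, 0))"
    by (rule code_forI) (auto simp: ev_simps oracle_graph_def)
  then show ?case ..
next
  case (pair f g)
  then obtain c d where c: "code_for Z f c" and d: "code_for Z g d" by blast
  have "code_for Z (\<lambda>n. Option.bind (f n) (\<lambda>a. Option.bind (g n) (\<lambda>b. Some (prod_encode (a, b)))))
      (prod_encode (5, prod_encode (c, d)))"
  proof (rule code_forI)
    fix Q n v assume Q: "Z = {} \<or> Q = oracle_graph Z"
    show "Option.bind (f n) (\<lambda>a. Option.bind (g n) (\<lambda>b. Some (prod_encode (a, b)))) = Some v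
        \<longleftrightarrow> ev Q (prod_encode (5, prod_encode (c, d))) n v"
      unfolding ev_simps bind_eq_Some_conv code_forD[OF c Q] code_forD[OF d Q] by blast
  qed
  then show ?case ..
next
  case (comp f g)
  then obtain c d where c: "code_for Z f c" and d: "code_for Z g d" by blast
  have "code_for Z (\<lambda>n. Option.bind (g n) f) (prod_encode (6, prod_encode (c, d)))"
  proof (rule code_forI)
    fix Q n v assume Q: "Z = {} \<or> Q = oracle_graph Z"
    show "Option.bind (g n) f = Some v \<longleftrightarrow> ev Q (prod_encode (6, prod_encode (c, d))) n v"
      unfolding ev_simps bind_eq_Some_conv code_forD[OF c Q] code_forD[OF d Q] by blast
  qed
  then show ?case ..
next
  case (rec f g)
  then obtain c d where c: "code_for Z f c" and d: "code_for Z g d" by blast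
  let ?h = "\<lambda>a. rec_nat (f a)
    (\<lambda>k r. Option.bind r (\<lambda>v. g (prod_encode (a, prod_encode (k, v)))))"
  have h: "?h a m = Some v \<longleftrightarrow> ev Q (prod_encode (7, prod_encode (c, d))) (prod_encode (a, m)) v"
    if "Z = {} \<or> Q = oracle_graph Z" for Q a m v
  proof (induction m arbitrary: v)
    case 0
    show ?case by (simp add: ev_simps code_forD[OF c that])
  next
    case (Suc m)
    show ?case
      by (simp add: ev_simps bind_eq_Some_conv code_forD[OF d that] Suc.IH)
  qed
  have "code_for Z (\<lambda>n. ?h (pfst n) (psnd n)) (prod_encode (7, prod_encode (c, d)))"
  proof (rule code_forI)
    fix Q n v assume Q: "Z = {} \<or> Q = oracle_graph Z"
    show "?h (pfst n) (psnd n) = Some v \<longleftrightarrow> ev Q (prod_encode (7, prod_encode (c, d))) n v"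
      using h[OF Q, of "pfst n" "psnd n" v] by simp
  qed
  then show ?case ..
next
  case (mu f)
  then obtain c where c: "code_for Z f c" by blast
  \<comment> \<open>\<open>?i\<close> codes the identity as the pair of both projections;
    \<open>?e\<close> pairs the input \<open>a\<close> with the start value \<open>0\<close> before
    searching.\<close>
  let ?i = "prod_encode (5, prod_encode (prod_encode (2, 0), prod_encode (3, 0)))"
  let ?e = "prod_encode (6, prod_encode (prod_encode (8, c),
      prod_encode (5, prod_encode (?i, prod_encode (0, 0)))))"
  have e: "ev Q ?e a v \<longleftrightarrow> ev Q (prod_encode (8, c)) (prod_encode (a, 0)) v" for Q a v
    by (simp add: ev_simps)
  have "code_for Z (\<lambda>a. if \<exists>k. f (prod_encode (a, k)) = Some 0 \<and>
        (\<forall>j<k. f (prod_encode (a, j)) \<noteq> None)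
      then Some (LEAST k. f (prod_encode (a, k)) = Some 0) else None) ?e"
  proof (rule code_forI)
    fix Q a v assume Q: "Z = {} \<or> Q = oracle_graph Z"
    show "(if \<exists>k. f (prod_encode (a, k)) = Some 0 \<and> (\<forall>j<k. f (prod_encode (a, j)) \<noteq> None)
        then Some (LEAST k. f (prod_encode (a, k)) = Some 0) else None) = Some v \<longleftrightarrow> ev Q ?e a v"
      unfolding e mu_eq_Some_iff ev_mu_iff[OF code_forD[OF c Q]] by simp
  qed
  then show ?case ..
qed

text \<open>The oracle is meant to be the graph of a function whose first values are listed in
  \<open>l\<close>. A query \<open>n\<close> asks whether \<open>psnd n\<close> is the value at
  \<open>pfst n\<close>, and has no answer beyond the list.\<close>

definition finite_oracle :: "nat list \<Rightarrow> nat \<Rightarrow> nat \<Rightarrow> bool" where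
  "finite_oracle l n r \<longleftrightarrow> pfst n < length l \<and> r = (if l ! pfst n = psnd n then 1 else 0)"

lemma ce_finite_oracle [ce_intros]:
  assumes [recursive_intros]: "recursive_in Z f" "recursive_in Z g" "recursive_in Z h"
  shows "ce_in Z {x. finite_oracle (list_decode (f x)) (g x) (h x)}"
proof -
  have "finite_oracle l n r \<longleftrightarrow> (\<exists>y. (pfst n < length l \<and> l ! pfst n = y) \<and>
      (y = psnd n \<and> r = 1 \<or> y \<noteq> psnd n \<and> r = 0))" for l n r
    by (auto simp: finite_oracle_def)
  then show ?thesis
    by (simp only:) (intro ce_ex ce_nth ce_conj ce_disj ce_eq ce_neq recursive_intros
        assms[THEN recursive_comp])
qed

text \<open>Evaluation statements become numbers, and the clauses of \<open>ev\<close> become axioms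
  \<open>A\<close> and rules \<open>T\<close> of a derivation. The oracle list is carried inside
  each statement, so that \<open>A\<close> and \<open>T\<close> do not vary with the input
  \<open>x\<close>.\<close>

lemma ce_ev [ce_intros]:
  assumes f: "recursive_in Z f" "recursive_in Z g" "recursive_in Z h" "recursive_in Z k"
  shows "ce_in Z {x. ev (finite_oracle (list_decode (f x))) (g x) (h x) (k x)}"
proof -
  let ?F = "\<lambda>t c n v. prod_encode (t, prod_encode (c, prod_encode (n, v)))"
  define A where "A = {x. \<exists>t c n v e. x = ?F t c n v \<and>
      (c = prod_encode (0, e) \<and> v = 0 \<or> c = prod_encode (1, e) \<and> v = Suc n \<or>
       c = prod_encode (2, e) \<and> v = pfst n \<or> c = prod_encode (3, e) \<and> v = psnd n \<or>
       c = prod_encode (4, e) \<and> finite_oracle (list_decode t) n v)}"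
  define T where "T = {z. \<exists>t c n v c1 n1 v1 c2 n2 v2.
      z = prod_encode (?F t c n v, prod_encode (?F t c1 n1 v1, ?F t c2 n2 v2)) \<and>
      (c = prod_encode (5, prod_encode (c1, c2)) \<and> n1 = n \<and> n2 = n \<and> v = prod_encode (v1, v2) \<or>
       c = prod_encode (6, prod_encode (c2, c1)) \<and> n1 = n \<and> n2 = v1 \<and> v = v2 \<or>
       (\<exists>d. c = prod_encode (7, prod_encode (c1, d)) \<and> n = prod_encode (n1, 0) \<and> v = v1 \<and>
          c2 = c1 \<and> n2 = n1 \<and> v2 = v1) \<or>
       (\<exists>d a k. c = prod_encode (7, prod_encode (d, c2)) \<and> c1 = c \<and> n1 = prod_encode (a, k) \<and>
          n2 = prod_encode (a, prod_encode (k, v1)) \<and> n = prod_encode (a, Suc k) \<and> v = v2) \<or>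
       (\<exists>a k. c = prod_encode (8, c1) \<and> n = prod_encode (a, k) \<and> n1 = n \<and> v1 = 0 \<and> v = k \<and>
          c2 = c1 \<and> n2 = n1 \<and> v2 = v1) \<or>
       (\<exists>a k w. c = prod_encode (8, c1) \<and> n = prod_encode (a, k) \<and> n1 = n \<and> v1 = Suc w \<and>
          c2 = c \<and> n2 = prod_encode (a, Suc k) \<and> v2 = v))}"
  have A: "ce_in Z A" unfolding A_def by (intro ce_intros recursive_intros)
  have T: "ce_in Z T" unfolding T_def by (intro ce_intros recursive_intros)
  have "derivable A T (?F t c n v)" if "ev (finite_oracle (list_decode t)) c n v" for t c n v
    using that
  proof induction
    case (pair c n a d b)
    show ?case
      by (rule derivable.step[OF _ pair.IH]) (simp add: T_def)
  next
    case (comp d n a c v)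
    show ?case
      by (rule derivable.step[OF _ comp.IH]) (simp add: T_def)
  next
    case (rec_0 c a v d)
    show ?case
      by (rule derivable.step[OF _ rec_0.IH rec_0.IH]) (simp add: T_def)
  next
    case (rec_Suc c d a k w v)
    show ?case
      by (rule derivable.step[OF _ rec_Suc.IH]) (simp add: T_def)
  next
    case (mu_0 c a k)
    show ?case
      by (rule derivable.step[OF _ mu_0.IH mu_0.IH]) (simp add: T_def)
  next
    case (mu_Suc c a k w v)
    show ?case
      by (rule derivable.step[OF _ mu_Suc.IH]) (simp add: T_def)
  qed (auto intro!: derivable.axiom simp: A_def)
  moreover have "ev (finite_oracle (list_decode t)) c n v" if "derivable A T (?F t c n v)" for t c n v
    using that
  proof (induction "?F t c n v" arbitrary: t c n v)
    case axiom
    then show ?case by (auto simp: A_def ev_simps)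
  next
    case (step p q)
    then show ?case unfolding T_def
      by (elim CollectE exE conjE disjE) (auto intro: ev.intros)
  qed
  ultimately have "ev (finite_oracle (list_decode t)) c n v \<longleftrightarrow> derivable A T (?F t c n v)" for t c n v
    by blast
  then show ?thesis
    by (simp only:) (intro ce_derivable A T recursive_intros f)
qed

lemma ce_universal:
  obtains U where "ce U" "\<And>V. ce V \<Longrightarrow> \<exists>n. \<forall>x. x \<in> V \<longleftrightarrow> prod_encode (n, x) \<in> U"
proof
  \<comment> \<open>\<open>list_decode 0\<close> is the empty list, an oracle that never answers.
    This is harmless, since \<open>code_for {}\<close> gives codes that are correct for every oracle
    relation.\<close>
  let ?U = "{z. \<exists>v. ev (finite_oracle (list_decode 0)) (pfst z) (psnd z) v}"
  show "ce ?U" by (intro ce_intros recursive_intros)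
  fix V assume "ce V"
  then obtain f where f: "partial_recursive_in {} f" "V = dom f" by (auto simp: ce_in_def)
  then obtain c where "code_for {} f c" using partial_recursive_code by blast
  then have "\<And>Q n v. f n = Some v \<longleftrightarrow> ev Q c n v" using code_forD by blast
  then show "\<exists>n. \<forall>x. x \<in> V \<longleftrightarrow> prod_encode (n, x) \<in> ?U"
    by (intro exI[of _ c]) (auto simp: f(2))
qed

subsection \<open>Selman's theorem\<close>

lemma ev_mono:
  assumes "ev Q c n v" "\<And>n r. Q n r \<Longrightarrow> Q' n r"
  shows "ev Q' c n v"
  using assms(1) by induction (rule ev.intros; (assumption | erule assms(2)))+

text \<open>The use principle: a halting computation makes finitely many queries, and in an
  increasing chain of partial oracles some level answers them all.\<close>

lemma ev_finite_use:
  assumes "ev Q c n v" and Q: "\<And>n r. Q n r \<Longrightarrow> \<exists>k. q k n r"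
    and q: "\<And>k k' n r. q k n r \<Longrightarrow> k \<le> k' \<Longrightarrow> q k' n r"
  shows "\<exists>k::nat. ev (q k) c n v"
proof -
  have up: "ev (q k') c n v" if "ev (q k) c n v" "k \<le> k'" for k k' c n v
    using ev_mono[OF that(1)] q that(2) by blast
  have max: "\<exists>k. ev (q k) c n v \<and> ev (q k) d m w"
    if "\<exists>k. ev (q k) c n v" "\<exists>k. ev (q k) d m w" for c n v d m w
    using that up by (meson nat_le_linear)
  show ?thesis using assms(1)
  proof induction
    case (query n r c)
    then show ?case using Q ev.query by metis
  next
    case (pair c n a d b)
    then show ?case using max[OF pair.IH] by (blast intro: ev.pair)
  next
    case (comp d n a c v)
    then show ?case using max[OF comp.IH] by (blast intro: ev.comp)
  next
    case (rec_0 c a v d)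
    then show ?case by (blast intro: ev.rec_0)
  next
    case (rec_Suc c d a k w v)
    then show ?case using max[OF rec_Suc.IH] by (blast intro: ev.rec_Suc)
  next
    case (mu_0 c a k)
    then show ?case by (blast intro: ev.mu_0)
  next
    case (mu_Suc c a k w v)
    then show ?case using max[OF mu_Suc.IH] by (blast intro: ev.mu_Suc)
  qed (rule exI, rule ev.intros)+
qed

lemma recursive_list_append:
  "recursive_in Z f \<Longrightarrow> recursive_in Z (\<lambda>x. list_encode (l @ list_decode (f x)))"
  by (induction l) (simp_all add: recursive_intros)

lemma ce_in_self: "ce_in Z Z"
proof -
  have "recursive_in Z (\<lambda>n. if n \<in> Z then 1 else 0)"
    unfolding recursive_in_def by (rule partial_recursive_in.query)
  from ce_eq[OF this recursive_const[of Z 1]] have "ce_in Z {n. (if n \<in> Z then 1 else 0) = (1::nat)}" .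
  moreover have "{n. (if n \<in> Z then 1 else 0) = (1::nat)} = Z" by auto
  ultimately show ?thesis by simp
qed

text \<open>A Baire category argument: countably many dense requirements on finite lists over
  \<open>S\<close> are met in turn by prolonging one list.\<close>

lemma generic_sequence:
  fixes D :: "nat \<Rightarrow> 'a list set"
  assumes "S \<noteq> {}"
    and dense: "\<And>n l. set l \<subseteq> S \<Longrightarrow> \<exists>u. set u \<subseteq> S \<and> l @ u \<in> D n"
  shows "\<exists>f. range f \<subseteq> S \<and> (\<forall>n. \<exists>k. map f [0..<k] \<in> D n)"
proof -
  obtain s where s: "s \<in> S" using assms(1) by blast
  have "\<exists>g. \<forall>n. (set (g n) \<subseteq> S \<and> n \<le> length (g n)) \<and>
      (\<exists>u v. g (Suc n) = g n @ u @ v \<and> g n @ u \<in> D n)"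
  proof (rule dependent_nat_choice)
    show "\<exists>l. set l \<subseteq> S \<and> 0 \<le> length l" by (intro exI[of _ "[]"]) simp
    fix l n assume l: "set l \<subseteq> S \<and> n \<le> length l"
    then obtain u where "set u \<subseteq> S" "l @ u \<in> D n" using dense by blast
    \<comment> \<open>The extra entry \<open>s\<close> forces the lengths to grow, so that the limit
      \<open>f\<close> below is defined at every position.\<close>
    with l s show "\<exists>l'. (set l' \<subseteq> S \<and> Suc n \<le> length l') \<and>
        (\<exists>u v. l' = l @ u @ v \<and> l @ u \<in> D n)"
      by (intro exI[of _ "l @ u @ [s]"]) auto
  qed
  then obtain g where gS: "\<And>n. set (g n) \<subseteq> S" and glen: "\<And>n. n \<le> length (g n)"
    and gD: "\<And>n. \<exists>u v. g (Suc n) = g n @ u @ v \<and> g n @ u \<in> D n"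
    by blast
  have ext: "\<exists>v. g n = g m @ v" if "m \<le> n" for m n
    using that
  proof (induction rule: dec_induct)
    case (step n)
    then show ?case using gD[of n] by auto
  qed simp
  define f where "f i = g (Suc i) ! i" for i
  have f: "f i = g n ! i" if "i < length (g n)" for i n
  proof (cases "n \<le> Suc i")
    case True
    then obtain v where "g (Suc i) = g n @ v" using ext by blast
    then show ?thesis using that by (simp add: f_def nth_append)
  next
    case False
    then obtain v where "g n = g (Suc i) @ v" using ext[of "Suc i" n] by auto
    then show ?thesis using glen[of "Suc i"] by (simp add: f_def nth_append)
  qed
  have "range f \<subseteq> S"
  proof
    fix y assume "y \<in> range f"
    then obtain i where "y = g (Suc i) ! i" by (auto simp: f_def)
    then show "y \<in> S" using gS[of "Suc i"] glen[of "Suc i"] nth_mem[of i "g (Suc i)"] by auto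
  qed
  moreover have "\<exists>k. map f [0..<k] \<in> D n" for n
  proof -
    obtain u v where u: "g (Suc n) = g n @ u @ v" "g n @ u \<in> D n" using gD by blast
    have "map f [0..<length (g n @ u)] = g n @ u"
    proof (rule nth_equalityI)
      fix i assume "i < length (map f [0..<length (g n @ u)])"
      then have i: "i < length (g n @ u)" by simp
      then have "f i = (g n @ u @ v) ! i" using f[of i "Suc n"] u(1) by simp
      with i show "map f [0..<length (g n @ u)] ! i = (g n @ u) ! i"
        by (simp del: append_assoc add: append_assoc[symmetric] nth_append)
    qed simp
    with u(2) show ?thesis by metis
  qed
  ultimately show ?thesis by blast
qed

text \<open>If no enumeration operator works, an oracle coding a sufficiently generic enumeration of
  \<open>S\<close> enumerates \<open>S\<close> but not \<open>A\<close>.\<close>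

theorem Selman:
  assumes "S \<noteq> {}" and rel: "\<And>Z. ce_in Z S \<Longrightarrow> ce_in Z A"
  shows "\<exists>V. ce V \<and> (\<forall>x. x \<in> A \<longleftrightarrow> (\<exists>u. prod_encode (x, u) \<in> V \<and> set (list_decode u) \<subseteq> S))"
proof (rule ccontr)
  assume no: "\<not> ?thesis"
  let ?halt = "\<lambda>l c x. \<exists>v. ev (finite_oracle l) c x v"
  \<comment> \<open>A list in \<open>E c\<close> refutes the program \<open>c\<close>: either
    \<open>c\<close> already halts outside \<open>A\<close>, or it can no longer halt on some
    element of \<open>A\<close>, whatever entries from \<open>S\<close> follow.\<close>
  define E where "E c = {l. (\<exists>x. x \<notin> A \<and> ?halt l c x) \<or>
      (\<exists>x\<in>A. \<forall>u. set u \<subseteq> S \<longrightarrow> \<not> ?halt (l @ u) c x)}" for c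
  have E: "\<exists>u. set u \<subseteq> S \<and> l @ u \<in> E c" if "set l \<subseteq> S" for l c
  proof (rule ccontr)
    assume neg: "\<nexists>u. set u \<subseteq> S \<and> l @ u \<in> E c"
    then have 1: "x \<in> A" if "set u \<subseteq> S" "?halt (l @ u) c x" for u x
      using that unfolding E_def by blast
    have "l \<notin> E c" using neg by (auto dest: spec[of _ "[]"])
    then have 2: "\<exists>u. set u \<subseteq> S \<and> ?halt (l @ u) c x" if "x \<in> A" for x
      using that unfolding E_def by blast
    \<comment> \<open>If \<open>l\<close> has no extension in \<open>E c\<close>, then running
      \<open>c\<close> on all extensions of \<open>l\<close> by elements of \<open>S\<close>
      enumerates exactly \<open>A\<close> and uses only positive information about \<open>S\<close>:
      an enumeration operator.\<close>
    let ?V = "{z. \<exists>v. ev (finite_oracle (list_decode (list_encode (l @ list_decode (psnd z))))) c (pfst z) v}"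
    have "ce ?V" by (intro ce_intros recursive_intros recursive_list_append)
    moreover have "x \<in> A \<longleftrightarrow> (\<exists>u. prod_encode (x, u) \<in> ?V \<and> set (list_decode u) \<subseteq> S)" for x
    proof
      assume "x \<in> A"
      from 2[OF this] obtain u where "set u \<subseteq> S \<and> ?halt (l @ u) c x" by blast
      then show "\<exists>u. prod_encode (x, u) \<in> ?V \<and> set (list_decode u) \<subseteq> S"
        by (intro exI[of _ "list_encode u"]) simp
    qed (use 1 in auto)
    ultimately show False using no by blast
  qed
  \<comment> \<open>Even indices make \<open>f\<close> list every element of \<open>S\<close>, odd
    ones defeat the programs \<open>c\<close> one by one.\<close>
  define D where "D n = (if even n then {l. n div 2 \<in> S \<longrightarrow> n div 2 \<in> set l} else E (n div 2))" for n
  have "\<exists>u. set u \<subseteq> S \<and> l @ u \<in> D n" if "set l \<subseteq> S" for l n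
  proof (cases "even n")
    case True
    show ?thesis
    proof (cases "n div 2 \<in> S")
      case in_S: True
      then show ?thesis using True by (intro exI[of _ "[n div 2]"]) (simp add: D_def)
    next
      case False
      then show ?thesis using True by (intro exI[of _ "[]"]) (simp add: D_def)
    qed
  qed (use E[OF that] in \<open>simp add: D_def\<close>)
  from generic_sequence[OF assms(1), of D, OF this] obtain f where
    fS: "range f \<subseteq> S" and fD: "\<And>n. \<exists>k. map f [0..<k] \<in> D n" by blast
  have S: "S = range f"
  proof (intro equalityI fS subsetI)
    fix y assume "y \<in> S"
    moreover obtain k where "map f [0..<k] \<in> D (2 * y)" using fD by blast
    ultimately show "y \<in> range f" by (auto simp: D_def)
  qed
  \<comment> \<open>The graph of \<open>f\<close> enumerates \<open>S\<close> as the range of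
    \<open>f\<close>, while each query to it is settled by an initial segment of
    \<open>f\<close>.\<close>
  define Z where "Z = (\<lambda>i. prod_encode (i, f i)) ` UNIV"
  let ?q = "\<lambda>k. finite_oracle (map f [0..<k])"
  have Z_mem: "n \<in> Z \<longleftrightarrow> f (pfst n) = psnd n" for n
    unfolding Z_def by (auto simp: image_iff) (metis prod.collapse prod_decode_inverse)
  have q_up: "?q k n r \<Longrightarrow> k \<le> k' \<Longrightarrow> ?q k' n r" for k k' n r
    by (auto simp: finite_oracle_def)
  have q_Z: "oracle_graph Z n r \<longleftrightarrow> (\<exists>k. ?q k n r)" for n r
  proof
    assume "oracle_graph Z n r"
    then have "?q (Suc (pfst n)) n r"
      by (simp add: oracle_graph_def finite_oracle_def Z_mem del: upt_Suc)
    then show "\<exists>k. ?q k n r" ..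
  next
    assume "\<exists>k. ?q k n r"
    then obtain k where "?q k n r" ..
    then show "oracle_graph Z n r"
      by (simp add: oracle_graph_def finite_oracle_def Z_mem split: if_splits)
  qed
  have "ce_in Z Z" by (rule ce_in_self)
  then have "ce_in Z {y. \<exists>i. prod_encode (i, y) \<in> Z}" by (intro ce_intros recursive_intros)
  moreover have "{y. \<exists>i. prod_encode (i, y) \<in> Z} = S" by (auto simp: Z_mem S)
  ultimately have "ce_in Z A" using rel by simp
  then obtain g where g: "partial_recursive_in Z g" "A = dom g" by (auto simp: ce_in_def)
  then obtain c where "code_for Z g c" using partial_recursive_code by blast
  then have c: "\<And>n v. g n = Some v \<longleftrightarrow> ev (oracle_graph Z) c n v" using code_forD by blast
  have A: "x \<in> A \<longleftrightarrow> (\<exists>k. ?halt (map f [0..<k]) c x)" for x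
  proof -
    have "x \<in> A \<longleftrightarrow> (\<exists>v. ev (oracle_graph Z) c x v)" by (auto simp: g(2) c[symmetric])
    also have "\<dots> \<longleftrightarrow> (\<exists>v k. ev (?q k) c x v)"
      using ev_finite_use[of "oracle_graph Z" c x _ ?q] q_Z q_up ev_mono[of "?q _" c x _ "oracle_graph Z"]
      by blast
    finally show ?thesis by blast
  qed
  obtain k where "map f [0..<k] \<in> D (2 * c + 1)" using fD by blast
  then have "map f [0..<k] \<in> E c" by (simp add: D_def)
  then consider x where "x \<notin> A" "?halt (map f [0..<k]) c x"
    | x where "x \<in> A" "\<forall>u. set u \<subseteq> S \<longrightarrow> \<not> ?halt (map f [0..<k] @ u) c x"
    unfolding E_def by blast
  then show False
  proof cases
    case 1
    then show False using A by blast
  next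
    case 2
    \<comment> \<open>The program does halt on \<open>x\<close> with a longer segment of
      \<open>f\<close>, which prolongs the first \<open>k\<close> values by entries from
      \<open>S\<close>.\<close>
    from 2(1) obtain m v where "ev (?q m) c x v" using A by blast
    then have "ev (?q (k + m)) c x v" using ev_mono q_up by (metis le_add2)
    moreover have "map f [0..<k + m] = map f [0..<k] @ map f [k..<k + m]"
      by (simp only: upt_add_eq_append[OF le0] map_append)
    moreover have "set (map f [k..<k + m]) \<subseteq> S" using fS by auto
    ultimately show False using 2(2) by auto
  qed
qed

subsection \<open>Rational balls\<close>

interpretation hcube: Metric_space hcube hdist
  by (rule Metric_space_hcube)

lemma rat_point_in_hcube [simp]: "rat_point l \<in> hcube"
  using range_rat_point by (auto simp: hcube_def)

lemma rat_radius_pos [simp]: "rat_radius r > 0"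
  using range_rat_radius by auto

lemma rat_ball_eq: "rat_ball n = hcube.mball (rat_point (pfst n)) (rat_radius (psnd n))"
  by (simp add: rat_ball_def case_prod_beta)

lemma in_rat_ball:
  "x \<in> rat_ball n \<longleftrightarrow> x \<in> hcube \<and> hdist (rat_point (pfst n)) x < rat_radius (psnd n)"
  by (simp add: rat_ball_eq)

text \<open>A formal counterpart of inclusion, as \<open>ball_apart\<close> is of disjointness:
  sufficient by the triangle inequality, and expressed by rational centres and radii alone, hence
  c.e.\<close>

definition ball_inside :: "nat \<Rightarrow> nat \<Rightarrow> bool" where
  "ball_inside n m \<longleftrightarrow>
    hdist (rat_point (pfst n)) (rat_point (pfst m)) + rat_radius (psnd n) \<le> rat_radius (psnd m)"

definition ball_apart :: "nat \<Rightarrow> nat \<Rightarrow> bool" where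
  "ball_apart n m \<longleftrightarrow>
    rat_radius (psnd n) + rat_radius (psnd m) \<le> hdist (rat_point (pfst n)) (rat_point (pfst m))"

lemma ball_inside_subset:
  assumes "ball_inside n m"
  shows "rat_ball n \<subseteq> rat_ball m"
proof
  fix x assume x: "x \<in> rat_ball n"
  then have "hdist (rat_point (pfst m)) x \<le>
      hdist (rat_point (pfst m)) (rat_point (pfst n)) + hdist (rat_point (pfst n)) x"
    by (intro hcube.triangle) (simp_all add: in_rat_ball)
  with x assms show "x \<in> rat_ball m"
    by (simp add: in_rat_ball ball_inside_def hcube.commute)
qed

lemma ball_apart_disjoint:
  assumes "ball_apart n m"
  shows "rat_ball n \<inter> rat_ball m = {}"
proof -
  have False if x: "x \<in> rat_ball n" "x \<in> rat_ball m" for x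
  proof -
    have "hdist (rat_point (pfst n)) (rat_point (pfst m)) \<le>
        hdist (rat_point (pfst n)) x + hdist x (rat_point (pfst m))"
      using x by (intro hcube.triangle) (simp_all add: in_rat_ball)
    with x assms show False
      by (simp add: in_rat_ball ball_apart_def hcube.commute)
  qed
  then show ?thesis by blast
qed

section \<open>Exact arithmetic for distances between rational points\<close>

abbreviation code_hd :: "nat \<Rightarrow> nat" where "code_hd l \<equiv> pfst (l - 1)"
abbreviation code_tl :: "nat \<Rightarrow> nat" where "code_tl l \<equiv> psnd (l - 1)"

text \<open>By truncated subtraction, head and tail of the code \<open>0\<close> are thus again
  \<open>0\<close>: the empty list acts as an endless list of zeros, matching the continuation of
  rational points.\<close>

lemma prod_decode_0 [simp]: "prod_decode 0 = (0, 0)"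
  by (metis prod_encode_inverse le_prod_encode_1 le_prod_encode_2 le_zero_eq prod.collapse
      prod_decode_inverse)

lemma rat01_0 [simp]: "rat01 0 = 0"
  by (simp add: rat01_def)

lemma rat_point_0 [simp]: "rat_point 0 i = 0"
  by (simp add: rat_point_def)

lemma rat_point_at_0: "rat_point l 0 = rat01 (code_hd l)"
  by (cases l) (simp_all add: rat_point_def case_prod_beta)

lemma rat_point_Suc: "rat_point l (Suc i) = rat_point (code_tl l) i"
  by (cases l) (simp_all add: rat_point_def case_prod_beta)

text \<open>The weights halve from one coordinate to the next, so the metric is self-similar under
  the shift. This is the recursion behind \<open>rat_dist\<close>.\<close>

lemma hdist_split_head:
  assumes x: "x \<in> hcube" and y: "y \<in> hcube"
  shows "hdist x y = \<bar>x 0 - y 0\<bar> + hdist (\<lambda>i. x (Suc i)) (\<lambda>i. y (Suc i)) / 2"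
proof -
  have x': "(\<lambda>i. x (Suc i)) \<in> hcube" and y': "(\<lambda>i. y (Suc i)) \<in> hcube"
    using x y by (auto simp: hcube_def)
  have "hdist x y = (\<Sum>i. \<bar>x (Suc i) - y (Suc i)\<bar> / 2 ^ Suc i) + \<bar>x 0 - y 0\<bar>"
    unfolding hdist_eq_suminf[OF x y]
    using suminf_split_head[OF summable_hdist[OF x y]] by simp
  also have "(\<Sum>i. \<bar>x (Suc i) - y (Suc i)\<bar> / 2 ^ Suc i) = hdist (\<lambda>i. x (Suc i)) (\<lambda>i. y (Suc i)) / 2"
    unfolding hdist_eq_suminf[OF x' y'] suminf_divide[OF summable_hdist[OF x' y'], symmetric]
    by (simp add: field_simps)
  finally show ?thesis by simp
qed

lemma hdist_rat_point:
  "hdist (rat_point l) (rat_point m) =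
    \<bar>rat01 (code_hd l) - rat01 (code_hd m)\<bar> + hdist (rat_point (code_tl l)) (rat_point (code_tl m)) / 2"
  by (subst hdist_split_head) (simp_all only: rat_point_at_0 rat_point_Suc rat_point_in_hcube)

text \<open>In truncated arithmetic \<open>a - (a - b)\<close> is the minimum of \<open>a\<close>
  and \<open>b\<close>; it carries out the cut-off at 1 in \<open>rat01\<close>.\<close>

abbreviation rat01_num :: "nat \<Rightarrow> nat" where "rat01_num c \<equiv> pfst c - (pfst c - Suc (psnd c))"
abbreviation rat01_den :: "nat \<Rightarrow> nat" where "rat01_den c \<equiv> Suc (psnd c)"

lemma rat01_eq: "rat01 c = real (rat01_num c) / real (rat01_den c)"
  by (auto simp: rat01_def case_prod_beta min_def divide_simps)

text \<open>\<open>rat_dist l m p q\<close> says that the points coded by \<open>l\<close> and \<open>m\<close> have distance \<open>p / q\<close>. The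
  truncated differences add up to an absolute value.\<close>

inductive rat_dist :: "nat \<Rightarrow> nat \<Rightarrow> nat \<Rightarrow> nat \<Rightarrow> bool" where
  nil: "rat_dist 0 0 0 1"
| cons: "rat_dist (code_tl l) (code_tl m) p q \<Longrightarrow>
    a = rat01_num (code_hd l) * rat01_den (code_hd m) \<Longrightarrow>
    b = rat01_num (code_hd m) * rat01_den (code_hd l) \<Longrightarrow>
    d = rat01_den (code_hd l) * rat01_den (code_hd m) \<Longrightarrow>
    rat_dist l m ((a - b + (b - a)) * (2 * q) + p * d) (2 * q * d)"

lemma rat_dist_sound:
  "rat_dist l m p q \<Longrightarrow> q > 0 \<and> hdist (rat_point l) (rat_point m) = real p / real q"
proof (induction rule: rat_dist.induct)
  case nil
  have "hdist (rat_point 0) (rat_point 0) = 0" by simp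
  then show ?case by (simp del: rat_point_0)
next
  case (cons l m p q a b d)
  let ?dl = "real (rat01_den (code_hd l))" and ?dm = "real (rat01_den (code_hd m))"
  have d: "real d = ?dl * ?dm" "?dl > 0" "?dm > 0" by (simp_all only: cons.hyps of_nat_mult of_nat_0_less_iff zero_less_Suc)
  have "rat01 (code_hd l) - rat01 (code_hd m) = (real a - real b) / real d"
    unfolding rat01_eq cons.hyps(2,3) d(1) of_nat_mult using d(2,3) by (simp add: field_simps del: of_nat_Suc)
  moreover have "\<bar>real a - real b\<bar> = real (a - b + (b - a))"
    by (cases "a \<le> b") simp_all
  ultimately have abs: "\<bar>rat01 (code_hd l) - rat01 (code_hd m)\<bar> = real (a - b + (b - a)) / real d"
    by simp
  have frac: "real i / real j + real p / real k / 2 = real (i * (2 * k) + p * j) / real (2 * k * j)"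
    if "j > 0" "k > 0" for i j k
    using that by (simp add: field_simps)
  have d0: "d > 0" using cons.hyps(4) by simp
  have "hdist (rat_point l) (rat_point m) = real (a - b + (b - a)) / real d + real p / real q / 2"
    unfolding hdist_rat_point[of l m] abs using cons.IH by simp
  also have "\<dots> = real ((a - b + (b - a)) * (2 * q) + p * d) / real (2 * q * d)"
    using cons.IH d0 by (intro frac) simp_all
  finally show ?case using cons.IH d0 by simp
qed

text \<open>Taking tails decreases the sum of the codes until both are \<open>0\<close>. The
  fraction is not unique, as \<open>cons\<close> also applies at \<open>0\<close>, but by
  \<open>rat_dist_sound\<close> all choices have the same value.\<close>

lemma rat_dist_ex: "\<exists>p q. rat_dist l m p q"
proof (induction "l + m" arbitrary: l m rule: less_induct)
  case less
  show ?case
  proof (cases "l = 0 \<and> m = 0")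
    case False
    have tl_le: "code_tl k \<le> k - 1" for k
      using le_prod_encode_2[of "psnd (k - 1)" "pfst (k - 1)"] by simp
    have "code_tl l + code_tl m < l + m"
      using False tl_le[of l] tl_le[of m] by (cases l; cases m) simp_all
    then obtain p q where "rat_dist (code_tl l) (code_tl m) p q" using less by blast
    then show ?thesis using rat_dist.cons by blast
  qed (use rat_dist.nil in blast)
qed

lemma ce_rat_dist [ce_intros]:
  assumes f: "recursive_in Z f" "recursive_in Z g" "recursive_in Z h" "recursive_in Z k"
  shows "ce_in Z {x. rat_dist (f x) (g x) (h x) (k x)}"
proof -
  let ?F = "\<lambda>l m p q. prod_encode (l, prod_encode (m, prod_encode (p, q)))"
  let ?cons = "\<lambda>l m p q a b d P Q. a = rat01_num (code_hd l) * rat01_den (code_hd m) \<and>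
      b = rat01_num (code_hd m) * rat01_den (code_hd l) \<and>
      d = rat01_den (code_hd l) * rat01_den (code_hd m) \<and>
      P = (a - b + (b - a)) * (2 * q) + p * d \<and> Q = 2 * q * d"
  define A where "A = {x. x = ?F 0 0 0 1}"
  define T where "T = {z. \<exists>l m p q P Q a b d. z = prod_encode (?F l m P Q,
      prod_encode (?F (code_tl l) (code_tl m) p q, ?F (code_tl l) (code_tl m) p q)) \<and>
      ?cons l m p q a b d P Q}"
  have A: "ce_in Z A" unfolding A_def by (intro ce_intros recursive_intros)
  have T: "ce_in Z T" unfolding T_def by (intro ce_intros recursive_intros)
  have "derivable A T (?F l m p q)" if "rat_dist l m p q" for l m p q
    using that
  proof induction
    case nil
    show ?case by (rule derivable.axiom) (simp add: A_def)
  next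
    case (cons l m p q a b d)
    show ?case
      by (rule derivable.step[OF _ cons.IH cons.IH], unfold T_def) (use cons.hyps in blast)
  qed
  moreover have "rat_dist l m p q" if "derivable A T (?F l m p q)" for l m p q
    using that
  proof (induction "?F l m p q" arbitrary: l m p q)
    case axiom
    then show ?case using rat_dist.nil by (simp add: A_def)
  next
    case (step r s)
    then obtain p' q' a b d where r: "r = ?F (code_tl l) (code_tl m) p' q'"
      and eqs: "?cons l m p' q' a b d p q"
      unfolding T_def mem_Collect_eq prod_encode_eq prod.inject by blast
    have "rat_dist (code_tl l) (code_tl m) p' q'" using r by (rule step.hyps)
    from rat_dist.cons[OF this, of a b d] eqs show ?case by (simp only:)
  qed
  ultimately have "rat_dist l m p q \<longleftrightarrow> derivable A T (?F l m p q)" for l m p q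
    by blast
  then show ?thesis
    by (simp only:) (intro ce_derivable A T recursive_intros f)
qed

lemma rat_radius_eq: "rat_radius c = real (Suc (pfst c)) / real (Suc (psnd c))"
  by (simp add: rat_radius_def case_prod_beta)

text \<open>Clearing the positive denominators leaves an inequality between natural numbers.\<close>

lemma ball_inside_iff:
  "ball_inside n m \<longleftrightarrow> (\<exists>p q. rat_dist (pfst n) (pfst m) p q \<and>
    (p * Suc (psnd (psnd n)) + Suc (pfst (psnd n)) * q) * Suc (psnd (psnd m)) \<le>
      Suc (pfst (psnd m)) * (q * Suc (psnd (psnd n))))"
proof -
  have "real p / real q + real a / real b \<le> real c / real d \<longleftrightarrow> (p * b + a * q) * d \<le> c * (q * b)"
    if "q > 0" "b > 0" "d > 0" for p q a b c d :: nat
  proof -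
    have "real p / real q + real a / real b \<le> real c / real d \<longleftrightarrow>
        (real p * real b + real a * real q) * real d \<le> real c * (real q * real b)"
      using that by (simp add: add_frac_eq frac_le_eq divide_le_eq le_divide_eq pos_divide_le_eq field_simps)
    also have "\<dots> \<longleftrightarrow> real ((p * b + a * q) * d) \<le> real (c * (q * b))" by simp
    finally show ?thesis unfolding of_nat_le_iff .
  qed
  note * = this[OF _ zero_less_Suc zero_less_Suc]
  show ?thesis
    unfolding ball_inside_def rat_radius_eq
    using rat_dist_ex[of "pfst n" "pfst m"] rat_dist_sound[of "pfst n" "pfst m"] * by metis
qed

lemma ball_apart_iff:
  "ball_apart n m \<longleftrightarrow> (\<exists>p q. rat_dist (pfst n) (pfst m) p q \<and>
    (Suc (pfst (psnd n)) * Suc (psnd (psnd m)) + Suc (pfst (psnd m)) * Suc (psnd (psnd n))) * q \<le>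
      p * (Suc (psnd (psnd n)) * Suc (psnd (psnd m))))"
proof -
  have "real a / real b + real c / real d \<le> real p / real q \<longleftrightarrow> (a * d + c * b) * q \<le> p * (b * d)"
    if "q > 0" "b > 0" "d > 0" for p q a b c d :: nat
  proof -
    have "real a / real b + real c / real d \<le> real p / real q \<longleftrightarrow>
        (real a * real d + real c * real b) * real q \<le> real p * (real b * real d)"
      using that by (simp add: field_simps)
    also have "\<dots> \<longleftrightarrow> real ((a * d + c * b) * q) \<le> real (p * (b * d))" by simp
    finally show ?thesis unfolding of_nat_le_iff .
  qed
  note * = this[OF _ zero_less_Suc zero_less_Suc]
  show ?thesis
    unfolding ball_apart_def rat_radius_eq
    using rat_dist_ex[of "pfst n" "pfst m"] rat_dist_sound[of "pfst n" "pfst m"] * by metis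
qed

lemma ce_ball_inside [ce_intros]:
  assumes "recursive_in Z f" "recursive_in Z g"
  shows "ce_in Z {x. ball_inside (f x) (g x)}"
  unfolding ball_inside_iff
  by (intro ce_intros recursive_intros assms[THEN recursive_comp])

lemma ce_ball_apart [ce_intros]:
  assumes "recursive_in Z f" "recursive_in Z g"
  shows "ce_in Z {x. ball_apart (f x) (g x)}"
  unfolding ball_apart_iff
  by (intro ce_intros recursive_intros assms[THEN recursive_comp])

section \<open>Small balls and covers of compact sets\<close>

lemma rat_ball_small:
  assumes x: "x \<in> hcube" and "\<epsilon> > 0"
  shows "\<exists>n. x \<in> rat_ball n \<and> rat_radius (psnd n) < \<epsilon>"
proof -
  obtain r where r: "r \<in> \<rat>" "0 < r" "r < \<epsilon>" using Rats_dense_in_real[OF assms(2)] by blast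
  then obtain s where s: "rat_radius s = r" using range_rat_radius by (metis (mono_tags, lifting) image_iff mem_Collect_eq)
  have "openin hcube_topology (hcube.mball x r)" by simp
  then have "openin (product_topology (\<lambda>_. top_of_set {0..1}) UNIV) (hcube.mball x r)"
    by (simp only: hcube_topology_eq_product)
  from product_topology_open_contains_basis[OF this, of x] x r(2)
  obtain V where V: "x \<in> (\<Pi>\<^sub>E i\<in>UNIV. V i)" "\<And>i. openin (top_of_set {0..1::real}) (V i)"
      "finite {i. V i \<noteq> topspace (top_of_set {0..1})}" "(\<Pi>\<^sub>E i\<in>UNIV. V i) \<subseteq> hcube.mball x r"
    by auto
  \<comment> \<open>A basic neighbourhood in the product restricts only finitely many coordinates;
    all others may be \<open>0\<close>, which makes the approximating point finitely
    supported.\<close>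
  have "\<exists>q. q \<in> {0..1} \<inter> \<rat> \<and> q \<in> V i \<and> (V i = {0..1} \<longrightarrow> q = 0)" for i
  proof (cases "V i = {0..1}")
    case False
    have xi: "x i \<in> V i" using V(1) by auto
    obtain e where e: "e > 0" "ball (x i) e \<inter> {0..1} \<subseteq> V i"
      using V(2)[of i] xi unfolding openin_contains_ball by blast
    have x01: "0 \<le> x i" "x i \<le> 1" using x by (auto simp: hcube_def)
    \<comment> \<open>The clipped interval is nonempty even if \<open>x i\<close> is 0 or 1.\<close>
    then have "max 0 (x i - e) < min 1 (x i + e)" using e(1) by auto
    then obtain q where "q \<in> \<rat>" "max 0 (x i - e) < q" "q < min 1 (x i + e)"
      using Rats_dense_in_real by blast
    then have "q \<in> {0..1} \<inter> \<rat>" "q \<in> ball (x i) e \<inter> {0..1}"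
      by (auto simp: dist_real_def)
    with e(2) False show ?thesis by blast
  qed (intro exI[of _ 0]; simp)
  then obtain q where q: "\<And>i. q i \<in> {0..1} \<inter> \<rat>" "\<And>i. q i \<in> V i" "\<And>i. V i = {0..1} \<Longrightarrow> q i = 0"
    by metis
  have "finite {i. q i \<noteq> 0}"
    by (rule finite_subset[OF _ V(3)]) (use q(3) in auto)
  then have "q \<in> range rat_point" using q(1) unfolding range_rat_point by blast
  then obtain c where c: "rat_point c = q" by blast
  have "q \<in> hcube.mball x r" using V(4) q(2) by (metis PiE_UNIV_domain Pi_I subsetD)
  then have "x \<in> rat_ball (prod_encode (c, s))"
    using x by (simp add: in_rat_ball c s hcube.commute)
  then show ?thesis using r(3) s by (intro exI[of _ "prod_encode (c, s)"]) simp
qed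

text \<open>A notion of "eventually" for balls shrinking to \<open>x\<close>. It is closed under
  finite conjunctions, so one cover can meet several conditions at once.\<close>

definition small_balls_at :: "(nat \<Rightarrow> real) \<Rightarrow> (nat \<Rightarrow> bool) \<Rightarrow> bool" where
  "small_balls_at x G \<longleftrightarrow>
    (\<exists>\<epsilon>>0. \<forall>n. x \<in> rat_ball n \<longrightarrow> rat_radius (psnd n) < \<epsilon> \<longrightarrow> G n)"

lemma small_balls_at_conj:
  assumes "small_balls_at x G" "small_balls_at x H"
  shows "small_balls_at x (\<lambda>n. G n \<and> H n)"
proof -
  obtain e1 e2 where "e1 > 0" "e2 > 0"
    "\<forall>n. x \<in> rat_ball n \<longrightarrow> rat_radius (psnd n) < e1 \<longrightarrow> G n"
    "\<forall>n. x \<in> rat_ball n \<longrightarrow> rat_radius (psnd n) < e2 \<longrightarrow> H n"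
    using assms by (auto simp: small_balls_at_def)
  then show ?thesis unfolding small_balls_at_def by (intro exI[of _ "min e1 e2"]) auto
qed

lemma small_balls_at_finite:
  "finite I \<Longrightarrow> (\<And>i. i \<in> I \<Longrightarrow> small_balls_at x (G i)) \<Longrightarrow> small_balls_at x (\<lambda>n. \<forall>i\<in>I. G i n)"
proof (induction rule: finite_induct)
  case empty
  show ?case by (auto simp: small_balls_at_def intro: exI[of _ 1])
next
  case (insert i I)
  then show ?case using small_balls_at_conj[of x "G i"] by simp
qed

lemma small_balls_at_mono:
  "small_balls_at x G \<Longrightarrow> (\<And>n. G n \<Longrightarrow> H n) \<Longrightarrow> small_balls_at x H"
  unfolding small_balls_at_def by blast

lemma small_balls_at_inside:
  assumes x: "x \<in> rat_ball m"
  shows "small_balls_at x (\<lambda>n. ball_inside n m)"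
proof -
  \<comment> \<open>Half of the slack, because the distance from \<open>x\<close> to the new centre
    and the new radius each use up less than \<open>e\<close>.\<close>
  define e where "e = (rat_radius (psnd m) - hdist (rat_point (pfst m)) x) / 2"
  have "e > 0" using x by (simp add: e_def in_rat_ball)
  moreover have "ball_inside n m" if n: "x \<in> rat_ball n" "rat_radius (psnd n) < e" for n
  proof -
    have "hdist (rat_point (pfst n)) (rat_point (pfst m)) \<le>
        hdist (rat_point (pfst n)) x + hdist x (rat_point (pfst m))"
      using x by (intro hcube.triangle) (simp_all add: in_rat_ball)
    then show ?thesis using n x
      unfolding ball_inside_def in_rat_ball hcube.commute[of x] e_def by (simp add: field_simps)
  qed
  ultimately show ?thesis unfolding small_balls_at_def by blast
qed

lemma small_balls_at_inside_union:
  assumes "x \<in> ball_union d"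
  shows "small_balls_at x (\<lambda>n. \<exists>m\<in>set (list_decode d). ball_inside n m)"
  using assms by (auto simp: ball_union_def intro: small_balls_at_mono[OF small_balls_at_inside])

lemma small_balls_at_apart:
  assumes x: "x \<in> hcube" "rat_radius (psnd b) < hdist (rat_point (pfst b)) x"
  shows "small_balls_at x (\<lambda>n. ball_apart n b)"
proof -
  define e where "e = (hdist (rat_point (pfst b)) x - rat_radius (psnd b)) / 2"
  have "e > 0" using x by (simp add: e_def)
  moreover have "ball_apart n b" if n: "x \<in> rat_ball n" "rat_radius (psnd n) < e" for n
  proof -
    have "hdist (rat_point (pfst b)) x \<le>
        hdist (rat_point (pfst b)) (rat_point (pfst n)) + hdist (rat_point (pfst n)) x"
      using x by (intro hcube.triangle) simp_all
    then show ?thesis using n x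
      unfolding ball_apart_def in_rat_ball hcube.commute[of "rat_point (pfst b)" "rat_point (pfst n)"] e_def
      by (simp add: field_simps)
  qed
  ultimately show ?thesis unfolding small_balls_at_def by blast
qed

lemma compacts_subset_hcube: "K \<in> compacts \<Longrightarrow> K \<subseteq> hcube"
  using compactin_subset_topspace unfolding compacts_def by fastforce

lemma compacts_cover:
  assumes K: "K \<in> compacts" and G: "\<And>x. x \<in> K \<Longrightarrow> small_balls_at x G"
  shows "\<exists>d. K \<subseteq> ball_union d \<and> (\<forall>n\<in>set (list_decode d). G n)"
proof -
  let ?U = "rat_ball ` {n. G n}"
  have "K \<subseteq> \<Union>?U"
  proof
    fix x assume x: "x \<in> K"
    obtain e where e: "e > 0" "\<And>n. x \<in> rat_ball n \<Longrightarrow> rat_radius (psnd n) < e \<Longrightarrow> G n"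
      using G[OF x] unfolding small_balls_at_def by blast
    moreover have "x \<in> hcube" using compacts_subset_hcube[OF K] x by blast
    ultimately obtain n where "x \<in> rat_ball n" "rat_radius (psnd n) < e"
      using rat_ball_small by blast
    with e(2) show "x \<in> \<Union>?U" by blast
  qed
  moreover have "\<And>U. U \<in> ?U \<Longrightarrow> openin hcube_topology U" by (auto simp: rat_ball_eq)
  ultimately obtain F where "finite F" "F \<subseteq> ?U" "K \<subseteq> \<Union>F"
    using K compactinD[of hcube_topology K ?U] by (auto simp: compacts_def)
  then obtain N where N: "finite N" "N \<subseteq> {n. G n}" "K \<subseteq> \<Union>(rat_ball ` N)"
    by (metis finite_subset_image)
  obtain l where "set l = N" using finite_list[OF N(1)] by blast
  with N show ?thesis
    by (intro exI[of _ "list_encode l"]) (auto simp: ball_union_def)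
qed

lemma separating_ball:
  assumes K: "K \<in> compacts" and y: "y \<in> hcube" "y \<notin> K"
  obtains b where "y \<in> rat_ball b" "\<And>x. x \<in> K \<Longrightarrow> small_balls_at x (\<lambda>n. ball_apart n b)"
proof -
  have "closedin hcube_topology K"
    using K compactin_imp_closedin hcube.Hausdorff_space_mtopology unfolding compacts_def by blast
  then have "openin hcube_topology (hcube - K)" by (metis closedin_def hcube.topspace_mtopology)
  then obtain \<delta> where \<delta>: "\<delta> > 0" "hcube.mball y \<delta> \<subseteq> hcube - K"
    unfolding hcube.openin_mtopology using y by blast
  \<comment> \<open>Points of \<open>K\<close> are at least \<delta> away from \<open>y\<close>,
    hence more than \<delta>/2 from the centre of \<open>b\<close>. They thus exceed the radius
    strictly, which leaves room for formal apartness.\<close>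
  obtain b where b: "y \<in> rat_ball b" "rat_radius (psnd b) < \<delta> / 2"
    using rat_ball_small[OF y(1), of "\<delta> / 2"] \<delta>(1) by auto
  show thesis
  proof (rule that[OF b(1)])
    fix x assume x: "x \<in> K"
    then have xh: "x \<in> hcube" using compacts_subset_hcube[OF K] by blast
    have "\<not> hdist y x < \<delta>" using \<delta>(2) x y(1) xh by auto
    moreover have "hdist y x \<le> hdist y (rat_point (pfst b)) + hdist (rat_point (pfst b)) x"
      using y xh by (intro hcube.triangle) simp_all
    ultimately show "small_balls_at x (\<lambda>n. ball_apart n b)"
      using b xh by (intro small_balls_at_apart) (auto simp: in_rat_ball hcube.commute)
  qed
qed

subsection \<open>The characterisation\<close>

lemma ball_union_Cons: "ball_union (Suc (prod_encode (b, d))) = rat_ball b \<union> ball_union d"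
  by (simp add: ball_union_def)

lemma compacts_Diff_ball: "K \<in> compacts \<Longrightarrow> K - rat_ball b \<in> compacts"
proof -
  assume K: "K \<in> compacts"
  have "closedin hcube_topology (hcube - rat_ball b)"
    by (metis closedin_diff closedin_topspace hcube.openin_mball hcube.topspace_mtopology rat_ball_eq)
  then have "compactin hcube_topology ((hcube - rat_ball b) \<inter> K)"
    using K closed_Int_compactin unfolding compacts_def by blast
  moreover have "(hcube - rat_ball b) \<inter> K = K - rat_ball b"
    using compacts_subset_hcube[OF K] by blast
  ultimately show ?thesis by (simp add: compacts_def)
qed

lemma copy_of_compacts:
  assumes "copy_of X A Y B" "compact_space X" "compactin X A"
  shows "Y \<in> compacts" "B \<in> compacts" "B \<subseteq> Y"
proof -
  obtain f where Y: "Y \<subseteq> hcube" and f: "homeomorphic_map X (subspace Y) f" and B: "f ` A = B"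
    using assms(1) by (auto simp: copy_of_def)
  have cont: "continuous_map X (subspace Y) f" and im: "f ` topspace X = Y"
    using f Y homeomorphic_imp_continuous_map homeomorphic_imp_surjective_map[OF f]
    by (auto simp: inf.absorb2)
  have "compactin (subspace Y) (f ` topspace X)" "compactin (subspace Y) (f ` A)"
    using image_compactin[OF _ cont] assms(2,3) by (auto simp: compact_space_def)
  then show "Y \<in> compacts" "B \<in> compacts" "B \<subseteq> Y"
    unfolding im B by (auto simp: compactin_subtopology compacts_def)
qed

lemma minimal_for_imp_computable:
  assumes P: "uniformly_Pi01 P" and min: "minimal_for (P n) Y B" and "B \<subseteq> Y"
    and Y: "semicomputable_in Z Y" and B: "semicomputable_in Z B"
  shows "computable_in Z Y"
proof -
  obtain W where W: "ce W" and all_n: "\<forall>n. P n \<subseteq> compacts \<times> compacts \<and> compacts \<times> compacts - P n =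
      (\<Union>(d, e) \<in> {(d, e). prod_encode (n, prod_encode (d, e)) \<in> W}. upper_basic d \<times> upper_basic e)"
    using P unfolding uniformly_Pi01_def by (elim exE conjE) (rule that)
  note P_eq = all_n[rule_format, THEN conjunct2, of n]
  have notin: "(K, L) \<notin> P n \<longleftrightarrow> (\<exists>d e. prod_encode (n, prod_encode (d, e)) \<in> W \<and>
      K \<subseteq> ball_union d \<and> L \<subseteq> ball_union e)" if "K \<in> compacts" "L \<in> compacts" for K L
  proof -
    have "(K, L) \<in> compacts \<times> compacts - P n \<longleftrightarrow> (\<exists>d e. prod_encode (n, prod_encode (d, e)) \<in> W \<and>
        K \<subseteq> ball_union d \<and> L \<subseteq> ball_union e)"
      unfolding P_eq using that by (auto simp: upper_basic_def)
    then show ?thesis using that by simp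
  qed
  have YB: "Y \<in> compacts" "B \<in> compacts" using Y B by (auto simp: semicomputable_in_def)
  have meets: "rat_ball b \<inter> Y \<noteq> {} \<longleftrightarrow> (\<exists>d e. prod_encode (n, prod_encode (d, e)) \<in> W \<and>
      Y \<subseteq> ball_union (Suc (prod_encode (b, d))) \<and> B \<subseteq> ball_union (Suc (prod_encode (b, e))))" for b
  proof -
    have "rat_ball b \<inter> Y \<noteq> {} \<longleftrightarrow> (Y - rat_ball b, B - rat_ball b) \<notin> P n"
    proof
      assume "rat_ball b \<inter> Y \<noteq> {}"
      then have "proper_subpair (Y - rat_ball b) (B - rat_ball b) Y B"
        using YB compacts_Diff_ball \<open>B \<subseteq> Y\<close> by (auto simp: proper_subpair_def)
      then show "(Y - rat_ball b, B - rat_ball b) \<notin> P n" using min by (simp add: minimal_for_def)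
    next
      assume notin_P: "(Y - rat_ball b, B - rat_ball b) \<notin> P n"
      show "rat_ball b \<inter> Y \<noteq> {}"
      proof
        assume "rat_ball b \<inter> Y = {}"
        then have "Y - rat_ball b = Y" "B - rat_ball b = B" using \<open>B \<subseteq> Y\<close> by blast+
        with notin_P min show False by (simp add: minimal_for_def)
      qed
    qed
    \<comment> \<open>Covering a set with \<open>b\<close> removed amounts to covering the whole set
      once \<open>b\<close> is added to the cover, so the neighbourhoods of the smaller pair are
      read off from those of \<open>Y\<close> and \<open>B\<close>.\<close>
    then show ?thesis
      by (simp only: notin compacts_Diff_ball YB ball_union_Cons Diff_subset_conv)
  qed
  have "ce_in Z {b. \<exists>d e. prod_encode (n, prod_encode (d, e)) \<in> W \<and>
      Suc (prod_encode (b, d)) \<in> {e. Y \<subseteq> ball_union e} \<and>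
      Suc (prod_encode (b, e)) \<in> {e. B \<subseteq> ball_union e}}"
    using Y B by (intro ce_intros recursive_intros ce_imp_ce_in[OF W]) (simp_all add: semicomputable_in_def)
  then show ?thesis using Y unfolding computable_in_def meets by simp
qed

text \<open>The family is the same for all pairs: its \<open>n\<close>-th member belongs to the
  \<open>n\<close>-th operator, and \<open>(Y, B)\<close> only selects the index.\<close>

lemma minimal_property_family:
  obtains P where "uniformly_Pi01 P" "topological_invariant (\<Union>n. P n)"
    "\<And>Y B. Y \<in> compacts \<Longrightarrow> B \<in> compacts \<Longrightarrow>
       (\<And>Z. semicomputable_in Z Y \<Longrightarrow> semicomputable_in Z B \<Longrightarrow> computable_in Z Y) \<Longrightarrow>
       \<exists>n. minimal_for (P n) Y B"
proof -
  obtain U where U: "ce U" and univ: "\<And>V. ce V \<Longrightarrow> \<exists>n. \<forall>x. x \<in> V \<longleftrightarrow> prod_encode (n, x) \<in> U"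
    using ce_universal by blast
  \<comment> \<open>\<open>(b, u)\<close> is an axiom of the operator: output \<open>b\<close> once
    all neighbourhoods listed in \<open>u\<close> are present. The covers \<open>d\<close> and
    \<open>e\<close> guarantee this input formally, and \<open>d\<close> stays apart from
    \<open>b\<close>.\<close>
  define refines where "refines n b u d e \<longleftrightarrow> prod_encode (n, prod_encode (b, u)) \<in> U \<and>
      (\<forall>i\<in>set (list_decode d). \<forall>w\<in>set (list_decode u).
        \<exists>m\<in>set (list_decode (pfst w)). ball_inside i m) \<and>
      (\<forall>i\<in>set (list_decode e). \<forall>w\<in>set (list_decode u).
        \<exists>m\<in>set (list_decode (psnd w)). ball_inside i m) \<and>
      (\<forall>i\<in>set (list_decode d). ball_apart i b)" for n b u d e
  define W where "W = {z. \<exists>b u. refines (pfst z) b u (pfst (psnd z)) (psnd (psnd z))}"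
  define P where "P n = compacts \<times> compacts -
      (\<Union>(d, e) \<in> {(d, e). prod_encode (n, prod_encode (d, e)) \<in> W}. upper_basic d \<times> upper_basic e)" for n
  have "ce W" unfolding W_def refines_def by (intro ce_intros recursive_intros U)
  moreover have "compacts \<times> compacts - P n =
      (\<Union>(d, e) \<in> {(d, e). prod_encode (n, prod_encode (d, e)) \<in> W}. upper_basic d \<times> upper_basic e)" for n
    unfolding P_def upper_basic_def by blast
  moreover have "P n \<subseteq> compacts \<times> compacts" for n unfolding P_def by blast
  ultimately have Pi: "uniformly_Pi01 P" unfolding uniformly_Pi01_def by (intro exI[of _ W] conjI allI)
  have P_iff: "(K, L) \<in> P n \<longleftrightarrow>
      \<not> (\<exists>d e b u. refines n b u d e \<and> K \<subseteq> ball_union d \<and> L \<subseteq> ball_union e)"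
    if "K \<in> compacts" "L \<in> compacts" for K L n
    using that unfolding P_def W_def by (auto simp: upper_basic_def)
  have "ce {}" using ce_neq[OF recursive_id recursive_id, of "{}"] by simp
  then obtain n0 where "\<And>x. prod_encode (n0, x) \<notin> U" using univ by blast
  then have "(K, L) \<in> P n0" if "K \<in> compacts" "L \<in> compacts" for K L
    unfolding P_iff[OF that] by (simp add: refines_def)
  then have all: "(\<Union>n. P n) = compacts \<times> compacts"
    unfolding P_def by blast
  have inv: "topological_invariant (\<Union>n. P n)"
    unfolding topological_invariant_def all
  proof (clarsimp, intro conjI)
    fix K L Y B assume "K \<in> compacts" "L \<in> compacts" "L \<subseteq> K" "copy_of (subspace K) L Y B"
    then show "Y \<in> compacts" "B \<in> compacts"
      using copy_of_compacts[of "subspace K" L Y B]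
      by (auto simp: compacts_def compact_space_subtopology compactin_subtopology)
  qed
  show thesis
  proof (rule that[OF Pi inv])
    fix Y B assume Y: "Y \<in> compacts" and B: "B \<in> compacts"
      and comp: "\<And>Z. semicomputable_in Z Y \<Longrightarrow> semicomputable_in Z B \<Longrightarrow> computable_in Z Y"
    define S where "S = {w. Y \<subseteq> ball_union (pfst w) \<and> B \<subseteq> ball_union (psnd w)}"
    define A where "A = {b. rat_ball b \<inter> Y \<noteq> {}}"
    have cover: "\<exists>d. K \<subseteq> ball_union d" if "K \<in> compacts" for K
      using compacts_cover[OF that, of "\<lambda>_. True"] zero_less_one
      unfolding small_balls_at_def by blast
    obtain d0 where d0: "Y \<subseteq> ball_union d0" using cover[OF Y] ..
    obtain e0 where e0: "B \<subseteq> ball_union e0" using cover[OF B] ..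
    from d0 have "prod_encode (d0, e0) \<in> S" using e0 by (simp add: S_def)
    then have "S \<noteq> {}" by blast
    moreover have "ce_in Z A" if "ce_in Z S" for Z
    proof -
      \<comment> \<open>\<open>S\<close> codes the neighbourhoods of both sets at once; fixing one
        component at a known cover recovers those of the other set.\<close>
      have "ce_in Z {d. prod_encode (d, e0) \<in> S}" "ce_in Z {e. prod_encode (d0, e) \<in> S}"
        by (rule ce_mem[OF that], intro recursive_intros)+
      then have "semicomputable_in Z Y" "semicomputable_in Z B"
        using Y B d0 e0 by (simp_all add: semicomputable_in_def S_def)
      then show ?thesis using comp by (simp add: computable_in_def A_def)
    qed
    ultimately obtain V where "ce V"
      and V: "\<And>b. b \<in> A \<longleftrightarrow> (\<exists>u. prod_encode (b, u) \<in> V \<and> set (list_decode u) \<subseteq> S)"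
      using Selman by metis
    then obtain n where n: "\<And>x. x \<in> V \<longleftrightarrow> prod_encode (n, x) \<in> U" using univ by blast
    \<comment> \<open>A violation would make the operator output a ball \<open>b\<close>, which then
      meets \<open>Y\<close>, although a cover of \<open>Y\<close> is apart from
      \<open>b\<close>.\<close>
    have "(Y, B) \<in> P n"
    proof (rule ccontr)
      assume "(Y, B) \<notin> P n"
      then obtain d e b u where ref: "refines n b u d e" and d: "Y \<subseteq> ball_union d" and e: "B \<subseteq> ball_union e"
        using P_iff Y B by blast
      have "set (list_decode u) \<subseteq> S"
      proof
        fix w assume w: "w \<in> set (list_decode u)"
        have "ball_union d \<subseteq> ball_union (pfst w)" "ball_union e \<subseteq> ball_union (psnd w)"
          using ref w ball_inside_subset unfolding refines_def ball_union_def by fast+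
        then show "w \<in> S" using d e by (auto simp: S_def)
      qed
      then have "b \<in> A" using ref unfolding V n refines_def by blast
      moreover have "ball_union d \<inter> rat_ball b = {}"
        using ref ball_apart_disjoint unfolding refines_def ball_union_def by fast
      ultimately show False using d unfolding A_def by blast
    qed
    moreover have "(K, L) \<notin> P n" if "proper_subpair K L Y B" for K L
    proof -
      have K: "K \<in> compacts" and L: "L \<in> compacts" and sub: "K \<subset> Y" "L \<subseteq> B"
        using that by (auto simp: proper_subpair_def)
      obtain y where y: "y \<in> Y" "y \<notin> K" using sub(1) by blast
      then have "y \<in> hcube" using compacts_subset_hcube[OF Y] by blast
      from separating_ball[OF K this y(2)] obtain b where b: "y \<in> rat_ball b"
        and apart: "\<And>x. x \<in> K \<Longrightarrow> small_balls_at x (\<lambda>i. ball_apart i b)"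
        by blast
      have "b \<in> A" using b y(1) by (auto simp: A_def)
      then obtain u where u: "prod_encode (b, u) \<in> V" "set (list_decode u) \<subseteq> S" using V by blast
      \<comment> \<open>\<open>u\<close> lists finitely many neighbourhoods of
        \<open>(Y, B)\<close>, hence of \<open>(K, L)\<close>; sufficiently small balls lie formally
        inside all of them.\<close>
      let ?G = "\<lambda>i. \<forall>w\<in>set (list_decode u). \<exists>m\<in>set (list_decode (pfst w)). ball_inside i m"
      let ?H = "\<lambda>i. \<forall>w\<in>set (list_decode u). \<exists>m\<in>set (list_decode (psnd w)). ball_inside i m"
      have "small_balls_at x ?G" if "x \<in> K" for x
        using that u(2) sub(1)
        by (intro small_balls_at_finite small_balls_at_inside_union) (auto simp: S_def)
      then have "small_balls_at x (\<lambda>i. ?G i \<and> ball_apart i b)" if "x \<in> K" for x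
        using small_balls_at_conj apart that by blast
      from compacts_cover[OF K this] obtain d where
        d: "K \<subseteq> ball_union d" "\<forall>i\<in>set (list_decode d). ?G i \<and> ball_apart i b" by blast
      have "small_balls_at x ?H" if "x \<in> L" for x
        using that u(2) sub(2)
        by (intro small_balls_at_finite small_balls_at_inside_union) (auto simp: S_def)
      from compacts_cover[OF L this] obtain e where
        e: "L \<subseteq> ball_union e" "\<forall>i\<in>set (list_decode e). ?H i" by blast
      have "refines n b u d e" using u(1) d(2) e(2) unfolding refines_def n by blast
      then show ?thesis using P_iff[OF K L] d(1) e(1) by blast
    qed
    ultimately show "\<exists>n. minimal_for (P n) Y B" unfolding minimal_for_def by blast
  qed
qed

theorem theorem4p11:
  fixes X :: "'a topology" and A :: "'a set"
  assumes "compact_pair X A"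
  shows "strong_computable_type X A \<longleftrightarrow>
    (\<exists>P :: nat \<Rightarrow> pair_property.
       uniformly_Pi01 P \<and> topological_invariant (\<Union>n. P n) \<and>
       (\<forall>Y B. copy_of X A Y B \<longrightarrow> (\<exists>n. minimal_for (P n) Y B)))"
proof
  have X: "compact_space X" "compactin X A" using assms by (auto simp: compact_pair_def)
  {
    assume sct: "strong_computable_type X A"
    obtain P where "uniformly_Pi01 P" "topological_invariant (\<Union>n. P n)"
      and min: "\<And>Y B. Y \<in> compacts \<Longrightarrow> B \<in> compacts \<Longrightarrow>
       (\<And>Z. semicomputable_in Z Y \<Longrightarrow> semicomputable_in Z B \<Longrightarrow> computable_in Z Y) \<Longrightarrow>
       \<exists>n. minimal_for (P n) Y B"
      using minimal_property_family by blast
    moreover have "\<exists>n. minimal_for (P n) Y B" if "copy_of X A Y B" for Y B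
      using copy_of_compacts[OF that X] sct that
      by (intro min) (auto simp: strong_computable_type_def)
    ultimately show "\<exists>P :: nat \<Rightarrow> pair_property.
       uniformly_Pi01 P \<and> topological_invariant (\<Union>n. P n) \<and>
       (\<forall>Y B. copy_of X A Y B \<longrightarrow> (\<exists>n. minimal_for (P n) Y B))"
      by blast
  next
    assume "\<exists>P :: nat \<Rightarrow> pair_property.
       uniformly_Pi01 P \<and> topological_invariant (\<Union>n. P n) \<and>
       (\<forall>Y B. copy_of X A Y B \<longrightarrow> (\<exists>n. minimal_for (P n) Y B))"
    then show "strong_computable_type X A"
      unfolding strong_computable_type_def
      using minimal_for_imp_computable copy_of_compacts(3)[OF _ X] by blast
  }
qed

end
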